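(* Let $a=\sqrt{2(\sqrt{17}-1)}$, $b=\sqrt{17}-1$, $c=4$ (so that $\ln(a/c)/\ln(b/2c)=1/2$), and consider any hierarchical tiling based on the right triangle with short leg $a$, long leg $b$ and hypotenuse $c$. Then the tiling has exactly two sizes of tiles, each of which appears in an infinite number of orientations. The subdivision rule has the sibling edge-to-edge property, but the tiling is not globally edge-to-edge. Specifically, the tiles meet in an infinite number of ways.
   Context: Here $a^2+b^2=c^2$; let $\theta=\arcsin(a/c)$. A tile is a right triangle with an ordered triple of vertices $(A,C,B)$, with right angle at $C$ and angle $\theta$ at $A$, so that $|AC|:|CB|:|AB|=b:a:c$. $AC$ is called the long leg and $CB$ the short leg. Subdivision rule: let $F$ be the foot of the perpendicular from $C$ to $AB$, and let $M,N,K$ be the midpoints of $AC$, $AF$, $FC$. The tile $(A,C,B)$ is divided into the five daughter tiles $(A,N,M)$, $(M,K,C)$, $(M,K,F)$, $(F,N,M)$ (each smaller than the parent by the linear factor $b/(2c)$) and $(C,F,B)$ (smaller by the linear factor $a/c$). Let $T$ be the basic tile with hypotenuse $c$. Put $T_0=\{T\}$, and for $n\ge1$ let $T_n$ be obtained from $T_{n-1}$ by subdividing every tile of $T_{n-1}$ that has the largest hypotenuse occurring in $T_{n-1}$. A supertile of order $n$ is a collection of tiles of the form $e(s(T_n))$, where $s$ is a rescaling and $e$ is a Euclidean motion (possibly orientation reversing). A hierarchical tiling is a tiling of an infinite region (typically the whole plane) that is the union of supertiles $S_1\subsetneq S_2\subsetneq\cdots$ of orders $N_1<N_2<\cdots$,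 where for each $i$, writing $S_{i+1}=e(s(T_{N_{i+1}}))$, there are $n\le N_{i+1}$ and a tile $t\in T_n$ such that $S_i$ is the image under $e\circ s$ of the set of tiles of $T_{N_{i+1}}$ contained in $t$. The size of a tile is its hypotenuse length. The orientation of a tile is the element $g\in O(2)$ such that the tile is a translate of a positive multiple of $g(T)$. For edge-to-edge properties a tile is considered to have four vertices: the three corners and the midpoint of its long leg; its edges are the hypotenuse, the short leg and the two halves of the long leg. Sibling edge-to-edge: two daughter tiles of a single parent tile can meet only full edge to full edge. Globally edge-to-edge: any two tiles of the tiling meet only full edge to full edge. The number of ways in which tiles meet is the number of congruence classes of pairs of distinct tiles of the tiling whose boundaries share a segment of positive length. *)

theory Defs
  imports "HOL-Analysis.Analysis"
begin

text \<open>
  The Euclidean plane is \<^typ>\<open>complex\<close> with its standard inner product. A tile is the ordered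
  triple of vertices \<open>(A, C, B)\<close>: the right angle is at \<open>C\<close>, the long leg is \<open>AC\<close> and the
  short leg is \<open>CB\<close>.
\<close>

type_synonym tile = "complex \<times> complex \<times> complex"

fun is_tile :: "real \<Rightarrow> real \<Rightarrow> real \<Rightarrow> tile \<Rightarrow> bool" where
  "is_tile a b c (A, C, B) \<longleftrightarrow> orthogonal (A - C) (B - C) \<and>
     (\<exists>k>0. dist A C = k * b \<and> dist C B = k * a \<and> dist A B = k * c)"

definition basic_tile :: "real \<Rightarrow> real \<Rightarrow> tile" where
  "basic_tile a b = (Complex b 0, 0, Complex 0 a)"

fun tile_size :: "tile \<Rightarrow> real" where
  "tile_size (A, C, B) = dist A B"

fun tile_region :: "tile \<Rightarrow> complex set" where
  "tile_region (A, C, B) = convex hull {A, C, B}"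

fun map_tile :: "(complex \<Rightarrow> complex) \<Rightarrow> tile \<Rightarrow> tile" where
  "map_tile f (A, C, B) = (f A, f C, f B)"

definition foot :: "complex \<Rightarrow> complex \<Rightarrow> complex \<Rightarrow> complex" where
  "foot C A B = A + (((C - A) \<bullet> (B - A)) / ((B - A) \<bullet> (B - A))) *\<^sub>R (B - A)"

lemma foot_in_affine_hull: "foot C A B \<in> affine hull {A, B}"
proof -
  define u where "u = ((C - A) \<bullet> (B - A)) / ((B - A) \<bullet> (B - A))"
  have "foot C A B = (1 - u) *\<^sub>R A + u *\<^sub>R B"
    unfolding foot_def u_def[symmetric] by (simp add: algebra_simps)
  then show ?thesis
    unfolding affine_hull_2 by (intro CollectI exI[of _ "1 - u"] exI[of _ u]) simp
qed

lemma orthogonal_foot: "A \<noteq> B \<Longrightarrow> orthogonal (C - foot C A B) (B - A)"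
proof -
  assume "A \<noteq> B"
  then have "(B - A) \<bullet> (B - A) \<noteq> 0" by simp
  then show ?thesis
    by (simp add: foot_def orthogonal_def inner_add_left diff_diff_eq[symmetric]
        inner_diff_left[of "C - A"] del: inner_eq_zero_iff)
qed

fun subdivide :: "tile \<Rightarrow> tile set" where
  "subdivide (A, C, B) =
     (let F = foot C A B; M = midpoint A C; N = midpoint A F; K = midpoint F C
      in {(A, N, M), (M, K, C), (M, K, F), (F, N, M), (C, F, B)})"

definition subdivide_largest :: "tile set \<Rightarrow> tile set" where
  "subdivide_largest X =
     {t \<in> X. \<exists>u\<in>X. tile_size t < tile_size u} \<union>
     \<Union> (subdivide ` {t \<in> X. \<forall>u\<in>X. tile_size u \<le> tile_size t})"

text \<open>\<open>level_tiles a b n\<close> is $T_n$.\<close>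

primrec level_tiles :: "real \<Rightarrow> real \<Rightarrow> nat \<Rightarrow> tile set" where
  "level_tiles a b 0 = {basic_tile a b}"
| "level_tiles a b (Suc n) = subdivide_largest (level_tiles a b n)"

definition euclidean_motion :: "(complex \<Rightarrow> complex) \<Rightarrow> bool" where
  "euclidean_motion e \<longleftrightarrow> (\<exists>g v. orthogonal_transformation g \<and> e = (\<lambda>x. g x + v))"

definition rescaling :: "(complex \<Rightarrow> complex) \<Rightarrow> bool" where
  "rescaling s \<longleftrightarrow> (\<exists>r>0. s = (\<lambda>x. r *\<^sub>R x))"

definition supertile :: "real \<Rightarrow> real \<Rightarrow> nat \<Rightarrow> tile set \<Rightarrow> bool" where
  "supertile a b n S \<longleftrightarrow>
     (\<exists>e s. euclidean_motion e \<and> rescaling s \<and> S = map_tile (e \<circ> s) ` level_tiles a b n)"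

definition is_tiling_of :: "tile set \<Rightarrow> complex set \<Rightarrow> bool" where
  "is_tiling_of \<T> R \<longleftrightarrow>
     \<Union> (tile_region ` \<T>) = R \<and>
     pairwise (\<lambda>t u. interior (tile_region t) \<inter> interior (tile_region u) = {}) \<T>"

text \<open>The sequence $S_1, S_2, \dots$ is indexed from 0 here.\<close>

definition hierarchical_tiling :: "real \<Rightarrow> real \<Rightarrow> tile set \<Rightarrow> bool" where
  "hierarchical_tiling a b \<T> \<longleftrightarrow>
     (\<exists>R. is_tiling_of \<T> R \<and> \<not> bounded R) \<and>
     (\<exists>(S :: nat \<Rightarrow> tile set) (N :: nat \<Rightarrow> nat).
        \<T> = (\<Union>i. S i) \<and>
        (\<forall>i. supertile a b (N i) (S i)) \<and>
        (\<forall>i. S i \<subset> S (Suc i)) \<and>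
        (\<forall>i. N i < N (Suc i)) \<and>
        (\<forall>i. \<exists>e s. euclidean_motion e \<and> rescaling s \<and>
           S (Suc i) = map_tile (e \<circ> s) ` level_tiles a b (N (Suc i)) \<and>
           (\<exists>n \<le> N (Suc i). \<exists>t \<in> level_tiles a b n.
              S i = map_tile (e \<circ> s) `
                {u \<in> level_tiles a b (N (Suc i)). tile_region u \<subseteq> tile_region t})))"

text \<open>
  \<open>has_orientation a b t g\<close>: the element \<open>g\<close> of $O(2)$ is the orientation of the tile \<open>t\<close> relative
  to the basic tile. It is unique, since $g$ is determined by its values on the two legs.
\<close>

definition has_orientation :: "real \<Rightarrow> real \<Rightarrow> tile \<Rightarrow> (complex \<Rightarrow> complex) \<Rightarrow> bool" where
  "has_orientation a b t g \<longleftrightarrow> orthogonal_transformation g \<and>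
     (\<exists>r>0. \<exists>v. t = map_tile (\<lambda>x. r *\<^sub>R g x + v) (basic_tile a b))"

text \<open>The midpoint of the long leg counts as a vertex, so every tile has four edges.\<close>

fun tile_edges :: "tile \<Rightarrow> complex set set" where
  "tile_edges (A, C, B) =
     {closed_segment A B, closed_segment C B,
      closed_segment A (midpoint A C), closed_segment (midpoint A C) C}"

definition share_segment :: "complex set \<Rightarrow> complex set \<Rightarrow> bool" where
  "share_segment X Y \<longleftrightarrow> (\<exists>x y. x \<noteq> y \<and> closed_segment x y \<subseteq> X \<inter> Y)"

definition meet_full_edges :: "tile \<Rightarrow> tile \<Rightarrow> bool" where
  "meet_full_edges t u \<longleftrightarrow>
     (\<forall>e \<in> tile_edges t. \<forall>f \<in> tile_edges u. share_segment e f \<longrightarrow> e = f)"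

definition sibling_edge_to_edge :: "real \<Rightarrow> real \<Rightarrow> real \<Rightarrow> bool" where
  "sibling_edge_to_edge a b c \<longleftrightarrow>
     (\<forall>p. is_tile a b c p \<longrightarrow> pairwise meet_full_edges (subdivide p))"

definition globally_edge_to_edge :: "tile set \<Rightarrow> bool" where
  "globally_edge_to_edge \<T> \<longleftrightarrow> pairwise meet_full_edges \<T>"

definition meeting_pairs :: "tile set \<Rightarrow> tile set set" where
  "meeting_pairs \<T> =
     {{t, u} | t u. t \<in> \<T> \<and> u \<in> \<T> \<and> t \<noteq> u \<and>
        share_segment (frontier (tile_region t)) (frontier (tile_region u))}"

definition congruent_pairs :: "tile set \<Rightarrow> (tile set \<times> tile set) set" where
  "congruent_pairs \<T> =
     {(P, Q). P \<in> meeting_pairs \<T> \<and> Q \<in> meeting_pairs \<T> \<and>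
        (\<exists>e. euclidean_motion e \<and> Q = map_tile e ` P)}"

definition meeting_ways :: "tile set \<Rightarrow> tile set set set" where
  "meeting_ways \<T> = meeting_pairs \<T> // congruent_pairs \<T>"

end

theory Submission
  imports Defs
begin

text \<open>
  Put \<open>q = a / c\<close> and \<open>lam = 1 / q\<^sup>2 = (1 + sqrt 17) / 2\<close>, so that \<open>lam\<^sup>2 = lam + 4\<close>. The linear factors of
  the daughters are \<open>q\<close> and \<open>q\<^sup>2\<close>, hence a supertile of positive order has exactly two sizes, and nested
  supertiles share them.

  The daughter \<open>(M, K, F)\<close> is turned against its parent by the unit complex number
  \<open>turn = (b - i a) / c\<close>. The algebraic integer \<open>2 Re turn = lam - 1\<close> has the conjugate \<open>- lam\<close> of
  modulus larger than 2, so \<open>turn\<close> is not a root of unity and infinitely many orientations arise.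

  The daughters \<open>(M, K, F)\<close> and \<open>(F, N, M)\<close> share their hypotenuses with opposite orientations. Their
  descendants on the two sides of this fault line sit at positions in \<open>\<int>[lam]\<close>, which each step of
  the subdivision multiplies by \<open>lam\<close> up to a bounded translation. Because the conjugate
  \<open>(1 - sqrt 17) / 2\<close> of \<open>lam\<close> also has modulus larger than 1 (\<open>lam\<close> is not a Pisot number), the conjugates
  of the offsets between overlapping tiles are unbounded. So infinitely many offsets occur, and
  they are visible as distances between the corners \<open>A\<close> of meeting tiles.
\<close>

section \<open>Numbers and similarities\<close>

definition lam :: real where "lam = (1 + sqrt 17) / 2"

text \<open>The Galois conjugate of \<open>lam\<close>. Substituting it for \<open>lam\<close> in
  \<open>\<int>[lam]\<close> reveals the growth of integer coefficients that cannot be seen at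
  \<open>lam\<close> itself.\<close>

definition lam_conj :: real where "lam_conj = (1 - sqrt 17) / 2"

definition leg_a :: real where "leg_a = sqrt (2 * (sqrt 17 - 1))"

definition leg_b :: real where "leg_b = sqrt 17 - 1"

definition ratio :: real where "ratio = leg_a / 4"

abbreviation basic :: tile where "basic \<equiv> basic_tile leg_a leg_b"

lemma sqrt_17_bounds: "4.12 < sqrt 17" "sqrt 17 < 4.125"
proof -
  have "sqrt (4.12\<^sup>2) < sqrt 17" "sqrt 17 < sqrt (4.125\<^sup>2)"
    by (intro real_sqrt_less_mono; simp add: power2_eq_square)+
  then show "4.12 < sqrt 17" "sqrt 17 < 4.125"
    by (simp_all del: real_sqrt_less_iff)
qed

lemma lam_bounds: "2.56 < lam" "lam < 2.5625" "lam_conj < -1.56" "-1.5625 < lam_conj"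
  using sqrt_17_bounds by (simp_all add: lam_def lam_conj_def)

lemma lam_pos: "0 < lam"
  using lam_bounds by simp

lemma lam_sq: "lam * lam = lam + 4" "lam_conj * lam_conj = lam_conj + 4"
  by (simp_all add: lam_def lam_conj_def field_simps)

lemma leg_b_lam: "leg_b = 2 * (lam - 1)"
  by (simp add: leg_b_def lam_def)

lemma leg_b_pos: "0 < leg_b"
  using lam_bounds by (simp add: leg_b_lam)

lemma leg_a_sq: "leg_a * leg_a = 2 * leg_b"
  using leg_b_pos by (simp add: leg_a_def leg_b_def)

lemma leg_a_pos: "0 < leg_a"
  using leg_b_pos by (simp add: leg_a_def leg_b_def)

lemma legs_sq: "leg_a * leg_a + leg_b * leg_b = 16"
  by (simp add: leg_a_sq leg_b_def algebra_simps)

lemma ratio_pos: "0 < ratio" and ratio_less_1: "ratio < 1"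
proof -
  show "0 < ratio" using leg_a_pos by (simp add: ratio_def)
  have "leg_a * leg_a < 4 * 4"
    using leg_b_pos legs_sq by (smt (verit) mult_pos_pos)
  then have "leg_a < 4" 
    by (metis leg_a_pos less_eq_real_def linorder_not_less mult_mono' zero_le_numeral)
  then show "ratio < 1" by (simp add: ratio_def)
qed

text \<open>The first form is the factor \<open>b / (2 * c)\<close> of the small daughters; the
  second turns it into the reciprocal of an algebraic integer.\<close>

lemma ratio_sq: "ratio * ratio = leg_b / 8" "ratio * ratio = 1 / lam"
proof -
  show *: "ratio * ratio = leg_b / 8" by (simp add: ratio_def leg_a_sq)
  have "(lam - 1) * lam = 4" using lam_sq by (simp add: algebra_simps)
  then show "ratio * ratio = 1 / lam"
    using lam_pos unfolding * leg_b_lam by (simp add: field_simps)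
qed

text \<open>The left side is \<open>(b / c)^2\<close>, the fraction of the hypotenuse, measured from
  \<open>A\<close>, at which the foot of the altitude lies.\<close>

lemma long_leg_projection: "leg_b * leg_b / 16 = 4 / (lam * lam)"
proof -
  have "(lam - 1) * lam = 4" using lam_sq by (simp add: algebra_simps)
  then have "(lam - 1) = 4 / lam" using lam_pos by (simp add: field_simps)
  then show ?thesis unfolding leg_b_lam by simp
qed

text \<open>A rational algebraic integer is an integer, but \<open>lam\<close> lies strictly between
  2 and 3.\<close>

lemma lam_irrational: "lam \<notin> \<rat>"
proof
  have "poly [:-4, -1, 1:] lam = 0" using lam_sq(1) by (simp add: algebra_simps)
  moreover have "\<forall>i. coeff [:-4, -1, 1 :: real:] i \<in> \<int>"
    by (auto simp: coeff_pCons split: nat.splits)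
  ultimately have "algebraic_int lam"
    by (intro algebraic_int.intros[of "[:-4, -1, 1:]"]) auto
  moreover assume "lam \<in> \<rat>"
  ultimately have "lam \<in> \<int>" by (rule rational_algebraic_int_is_int)
  then obtain i :: int where "lam = of_int i" by (rule Ints_cases)
  with lam_bounds(1,2) have "2 < (of_int i :: real)" "(of_int i :: real) < 3" by simp_all
  then show False by simp
qed

text \<open>Uniqueness of coefficients is what makes conjugation in \<open>\<int>[lam]\<close>
  legitimate.\<close>

lemma int_lam_eq_0:
  fixes m k :: int
  assumes "of_int m + of_int k * lam = 0"
  shows "m = 0 \<and> k = 0"
proof -
  have "k = 0"
  proof (rule ccontr)
    assume "k \<noteq> 0"
    then have "lam = of_int (- m) / of_int k"
      using assms by (simp add: field_simps add_eq_0_iff2)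
    then have "lam \<in> \<rat>" by (metis Rats_divide Rats_of_int)
    then show False using lam_irrational by blast
  qed
  then show ?thesis using assms by simp
qed

lemma int_lam_eq_iff:
  fixes m k m' k' :: int
  shows "of_int m + of_int k * lam = of_int m' + of_int k' * lam \<longleftrightarrow> m = m' \<and> k = k'"
  using int_lam_eq_0[of "m - m'" "k - k'"] by (auto simp: algebra_simps)

section \<open>Similarities and their action on the subdivision\<close>

text \<open>Factor and linear part are parameters, so that the size of an image can be read off from
  \<open>r\<close> and its orientation from \<open>g\<close>.\<close>

definition similarity :: "real \<Rightarrow> (complex \<Rightarrow> complex) \<Rightarrow> (complex \<Rightarrow> complex) \<Rightarrow> bool" where
  "similarity r g f \<longleftrightarrow> r > 0 \<and> orthogonal_transformation g \<and> (\<exists>v. f = (\<lambda>x. r *\<^sub>R g x + v))"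

lemma similarityE:
  assumes "similarity r g f"
  obtains v where "r > 0" "linear g" "\<And>x y. g x \<bullet> g y = x \<bullet> y" "f = (\<lambda>x. r *\<^sub>R g x + v)"
  using assms by (auto simp: similarity_def orthogonal_transformation_def)

lemma similarity_id: "similarity 1 id id"
  unfolding similarity_def
  by (intro conjI exI[of _ 0]) (simp_all add: orthogonal_transformation_id id_def)

lemma similarity_comp:
  assumes "similarity r g f" "similarity r' g' f'"
  shows "similarity (r * r') (g \<circ> g') (f \<circ> f')"
proof -
  obtain v v' where v: "r > 0" "r' > 0" "f = (\<lambda>x. r *\<^sub>R g x + v)" "f' = (\<lambda>x. r' *\<^sub>R g' x + v')"
    "linear g"
    using assms by (metis similarityE)
  have "f \<circ> f' = (\<lambda>x. (r * r') *\<^sub>R (g \<circ> g') x + (r *\<^sub>R g v' + v))"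
    by (simp add: v fun_eq_iff linear_add[OF \<open>linear g\<close>] linear_scale[OF \<open>linear g\<close>]
        scaleR_add_right)
  then show ?thesis
    using assms v(1,2) orthogonal_transformation_compose unfolding similarity_def by auto
qed

lemma motion_rescaling_similarity:
  assumes "euclidean_motion e" "rescaling s"
  obtains r g where "similarity r g (e \<circ> s)"
proof -
  obtain g v r where *: "orthogonal_transformation g" "e = (\<lambda>x. g x + v)" "r > 0"
    "s = (\<lambda>x. r *\<^sub>R x)"
    using assms unfolding euclidean_motion_def rescaling_def by auto
  then have "e \<circ> s = (\<lambda>x. r *\<^sub>R g x + v)"
    by (simp add: fun_eq_iff orthogonal_transformation_linear linear_scale)
  with * that show ?thesis unfolding similarity_def by blast
qed

lemma similarity_dist:
  assumes "similarity r g f"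
  shows "dist (f x) (f y) = r * dist x y"
proof -
  obtain v where v: "r > 0" "linear g" "f = (\<lambda>x. r *\<^sub>R g x + v)"
    using assms by (metis similarityE)
  have "norm (g (x - y)) = norm (x - y)"
    using assms by (simp add: similarity_def orthogonal_transformation)
  moreover have "f x - f y = r *\<^sub>R g (x - y)"
    by (simp add: v linear_diff[OF v(2)] scaleR_diff_right)
  ultimately show ?thesis using v(1) by (simp add: dist_norm)
qed

lemma similarity_affine:
  assumes "similarity r g f"
  shows "f (x + t *\<^sub>R (y - x)) = f x + t *\<^sub>R (f y - f x)"
proof -
  obtain v where v: "linear g" "f = (\<lambda>x. r *\<^sub>R g x + v)"
    using assms by (metis similarityE)
  then show ?thesis
    by (simp add: linear_add[OF v(1)] linear_diff[OF v(1)] linear_scale[OF v(1)] algebra_simps)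
qed

lemma midpoint_affine: "midpoint x y = x + (1/2) *\<^sub>R (y - x)" for x y :: complex
  by (simp add: midpoint_def complex_eq_iff field_simps)

lemma similarity_midpoint:
  assumes "similarity r g f"
  shows "f (midpoint x y) = midpoint (f x) (f y)"
  unfolding midpoint_affine by (rule similarity_affine[OF assms])

text \<open>Both inner products in the affine parameter of the foot pick up the factor
  \<open>r^2\<close>, which cancels.\<close>

lemma similarity_foot:
  assumes "similarity r g f"
  shows "foot (f C) (f A) (f B) = f (foot C A B)"
proof -
  obtain v where v: "r > 0" "linear g" "\<And>x y. g x \<bullet> g y = x \<bullet> y" "f = (\<lambda>x. r *\<^sub>R g x + v)"
    using assms by (metis similarityE)
  have *: "(f x - f z) \<bullet> (f y - f z) = r\<^sup>2 * ((x - z) \<bullet> (y - z))" for x y z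
  proof -
    have "f x - f z = r *\<^sub>R g (x - z)" "f y - f z = r *\<^sub>R g (y - z)"
      by (simp_all add: v linear_diff[OF v(2)] scaleR_diff_right)
    then show ?thesis by (simp add: v(3) power2_eq_square)
  qed
  show ?thesis
    using v(1) unfolding foot_def * similarity_affine[OF assms] by simp
qed

fun big_daughter :: "tile \<Rightarrow> tile" where
  "big_daughter (A, C, B) = (C, foot C A B, B)"

fun small_daughters :: "tile \<Rightarrow> tile set" where
  "small_daughters (A, C, B) =
     (let F = foot C A B; M = midpoint A C; N = midpoint A F; K = midpoint F C
      in {(A, N, M), (M, K, C), (M, K, F), (F, N, M)})"

lemma subdivide_daughters: "subdivide t = insert (big_daughter t) (small_daughters t)"
  by (cases t) (simp add: Let_def insert_commute)

lemma big_daughter_map: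
  assumes "similarity r g f"
  shows "big_daughter (map_tile f t) = map_tile f (big_daughter t)"
  by (cases t) (simp add: similarity_foot[OF assms])

lemma small_daughters_map:
  assumes "similarity r g f"
  shows "small_daughters (map_tile f t) = map_tile f ` small_daughters t"
  by (cases t) (simp add: Let_def similarity_foot[OF assms] similarity_midpoint[OF assms])

lemma map_tile_comp: "map_tile (f \<circ> h) t = map_tile f (map_tile h t)"
  by (cases t) simp

lemma map_tile_id: "map_tile id t = t"
  by (cases t) simp

section \<open>The daughters of the basic tile\<close>

definition turn :: complex where "turn = Complex (leg_b / 4) (- leg_a / 4)"

text \<open>The reflection that is the linear part of the map from the basic tile to its big
  daughter.\<close>

definition mirror :: "complex \<Rightarrow> complex" where
  "mirror = (\<lambda>z. Complex (- leg_a / 4) (- leg_b / 4) * cnj z)"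

lemma norm_turn: "norm turn = 1"
  using legs_sq by (simp add: turn_def cmod_def power2_eq_square)

lemma orthogonal_transformation_mult:
  "norm w = 1 \<Longrightarrow> orthogonal_transformation (\<lambda>z. w * z)" for w :: complex
  by (simp add: orthogonal_transformation linear_iff algebra_simps norm_mult)

lemma orthogonal_transformation_mult_cnj:
  "norm w = 1 \<Longrightarrow> orthogonal_transformation (\<lambda>z. w * cnj z)"
  by (simp add: orthogonal_transformation linear_iff algebra_simps norm_mult)

lemma orthogonal_mirror: "orthogonal_transformation mirror"
proof -
  have "norm (Complex (- leg_a / 4) (- leg_b / 4)) = 1"
    using legs_sq by (simp add: cmod_def power2_eq_square)
  then show ?thesis unfolding mirror_def by (rule orthogonal_transformation_mult_cnj)
qed

lemma mirror_involution: "mirror \<circ> mirror = id"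
proof -
  have "Complex (- leg_a / 4) (- leg_b / 4) * cnj (Complex (- leg_a / 4) (- leg_b / 4)) = 1"
    using legs_sq by (simp add: complex_eq_iff)
  then show ?thesis by (simp add: mirror_def fun_eq_iff flip: mult.assoc)
qed

lemma foot_basic: 
  "foot 0 (Complex leg_b 0) (Complex 0 leg_a) = Complex (leg_a * leg_a * leg_b / 16) (leg_a * leg_b * leg_b / 16)"
proof -
  have a2: "leg_a * leg_a = 16 - leg_b * leg_b" using legs_sq by simp
  have "leg_a * leg_a * leg_b = 16 * leg_b - leg_b * leg_b * leg_b"
    by (simp add: a2 algebra_simps)
  then show ?thesis
    by (simp add: foot_def inner_complex_def complex_eq_iff a2 field_simps)
qed

lemma big_daughter_basic: "\<exists>f. similarity ratio mirror f \<and> big_daughter basic = map_tile f basic"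
proof -
  have a2: "leg_a * leg_a = 16 - leg_b * leg_b" using legs_sq by simp
  define F where "F = foot 0 (Complex leg_b 0) (Complex 0 leg_a)"
  have "leg_a * (leg_a * leg_a) = 16 * leg_a - leg_a * (leg_b * leg_b)"
    by (simp add: a2 algebra_simps)
  then have "big_daughter basic = map_tile (\<lambda>z. ratio *\<^sub>R mirror z + F) basic"
    by (simp add: basic_tile_def F_def foot_basic mirror_def ratio_def complex_eq_iff field_simps)
  then show ?thesis
    using ratio_pos orthogonal_mirror unfolding similarity_def by blast
qed

text \<open>This daughter is singled out with its explicit linear part, a rotation whose iteration
  yields the powers of \<open>turn\<close>.\<close>

lemma turned_daughter_basic:
  assumes "basic = (A, C, B)"
  shows "\<exists>f. similarity (ratio * ratio) (\<lambda>z. turn * z) f \<and>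
    (midpoint A C, midpoint (foot C A B) C, foot C A B) = map_tile f basic"
proof -
  have ABC: "A = Complex leg_b 0" "C = 0" "B = Complex 0 leg_a"
    using assms by (auto simp: basic_tile_def)
  have "leg_a * leg_a * leg_b + leg_b * leg_b * leg_b = 16 * leg_b"
    using legs_sq by (metis distrib_right)
  then have "(midpoint A C, midpoint (foot C A B) C, foot C A B) =
      map_tile (\<lambda>z. (ratio * ratio) *\<^sub>R (turn * z) + midpoint (foot C A B) C) basic"
    by (simp add: ABC basic_tile_def midpoint_def foot_basic ratio_sq(1) turn_def complex_eq_iff
        field_simps leg_a_sq)
  then show ?thesis
    using ratio_pos orthogonal_transformation_mult[OF norm_turn] unfolding similarity_def
    by (intro exI conjI) auto
qed

lemma small_daughters_basic:
  assumes "t \<in> small_daughters basic"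
  shows "\<exists>g f. similarity (ratio * ratio) g f \<and> t = map_tile f basic"
proof -
  define F where "F = foot 0 (Complex leg_b 0) (Complex 0 leg_a)"
  define M where "M = midpoint (Complex leg_b 0) 0"
  define N where "N = midpoint (Complex leg_b 0) F"
  define K where "K = midpoint F 0"
  have ot: "orthogonal_transformation (\<lambda>z. turn * cnj z)"
    "orthogonal_transformation (\<lambda>z. - turn * z)"
    using norm_turn
    by (intro orthogonal_transformation_mult orthogonal_transformation_mult_cnj; simp)+
  have bb: "leg_b * leg_b = 16 - 2 * leg_b" using legs_sq leg_a_sq by simp
  \<comment> \<open>Right-nested forms, so that squares also reduce inside longer products.\<close>
  have bbz: "leg_b * (leg_b * z) = 16 * z - 2 * (leg_b * z)" for z
    using arg_cong[OF bb, of "\<lambda>w. w * z"] by (simp add: algebra_simps)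
  have aaz: "leg_a * (leg_a * z) = 2 * (leg_b * z)" for z
    using arg_cong[OF leg_a_sq, of "\<lambda>w. w * z"] by (simp add: algebra_simps)
  have "t = (Complex leg_b 0, N, M) \<or> t = (M, K, 0) \<or> t = (M, K, F) \<or> t = (F, N, M)"
    using assms by (simp add: basic_tile_def Let_def F_def M_def N_def K_def)
  \<comment> \<open>The last two tiles share the hypotenuse \<open>MF\<close>, and their linear
    parts differ by a half turn.\<close>
  moreover have "(Complex leg_b 0, N, M) = map_tile (\<lambda>z. (ratio * ratio) *\<^sub>R (turn * cnj z) + N) basic"
    "(M, K, 0) = map_tile (\<lambda>z. (ratio * ratio) *\<^sub>R (turn * cnj z) + K) basic"
    "(M, K, F) = map_tile (\<lambda>z. (ratio * ratio) *\<^sub>R (turn * z) + K) basic"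
    "(F, N, M) = map_tile (\<lambda>z. (ratio * ratio) *\<^sub>R (- turn * z) + N) basic"
    by (simp_all add: basic_tile_def M_def N_def K_def F_def midpoint_def
        foot_basic ratio_sq(1) turn_def complex_eq_iff algebra_simps leg_a_sq bb bbz aaz)
      (simp_all add: field_simps)
  moreover have "similarity (ratio * ratio) g (\<lambda>z. (ratio * ratio) *\<^sub>R g z + v)"
    if "orthogonal_transformation g" for g v
    using that ratio_pos by (auto simp: similarity_def)
  ultimately show ?thesis
    using ot orthogonal_transformation_mult[OF norm_turn] by metis
qed

section \<open>Sizes and orientations\<close>

text \<open>A small daughter advances the index by two because \<open>b / (2 * c) = (a / c)\<^sup>2\<close>, so the index of a
  tile determines its size \<open>4 * ratio ^ w\<close>.\<close>

inductive tile_at :: "nat \<Rightarrow> tile \<Rightarrow> bool" where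
  base: "tile_at 0 basic"
| big: "tile_at w t \<Longrightarrow> tile_at (Suc w) (big_daughter t)"
| small: "tile_at w t \<Longrightarrow> u \<in> small_daughters t \<Longrightarrow> tile_at (Suc (Suc w)) u"

text \<open>Subdivision commutes with similarities, so a daughter of \<open>map_tile f basic\<close>
  is the image under \<open>f\<close> of a daughter of \<open>basic\<close>.\<close>

lemma tile_at_similar:
  assumes "tile_at w t"
  shows "\<exists>g f. similarity (ratio ^ w) g f \<and> t = map_tile f basic"
  using assms
proof induction
  case base
  show ?case using similarity_id map_tile_id by (metis power_0)
next
  case (big w t)
  then obtain g f where f: "similarity (ratio ^ w) g f" "t = map_tile f basic" by blast
  obtain h where h: "similarity ratio mirror h" "big_daughter basic = map_tile h basic"
    using big_daughter_basic by blast
  have "similarity (ratio ^ Suc w) (g \<circ> mirror) (f \<circ> h)"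
    using similarity_comp[OF f(1) h(1)] by (simp add: mult.commute)
  moreover have "big_daughter t = map_tile (f \<circ> h) basic"
    by (simp add: f(2) big_daughter_map[OF f(1)] h(2) map_tile_comp)
  ultimately show ?case by blast
next
  case (small w t u)
  then obtain g f where f: "similarity (ratio ^ w) g f" "t = map_tile f basic" by blast
  with small obtain u' where u': "u = map_tile f u'" "u' \<in> small_daughters basic"
    by (auto simp: small_daughters_map)
  then obtain g' h where h: "similarity (ratio * ratio) g' h" "u' = map_tile h basic"
    using small_daughters_basic by blast
  have "similarity (ratio ^ Suc (Suc w)) (g \<circ> g') (f \<circ> h)"
    using similarity_comp[OF f(1) h(1)] by (simp add: ac_simps)
  moreover have "u = map_tile (f \<circ> h) basic"
    by (simp add: u'(1) h(2) map_tile_comp)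
  ultimately show ?case by blast
qed

lemma size_map_tile: "similarity r g f \<Longrightarrow> tile_size (map_tile f t) = r * tile_size t"
  by (cases t) (simp add: similarity_dist)

lemma size_basic: "tile_size basic = 4"
proof -
  have "leg_b\<^sup>2 + leg_a\<^sup>2 = 4\<^sup>2" using legs_sq by (simp add: power2_eq_square)
  then have "sqrt (leg_b\<^sup>2 + leg_a\<^sup>2) = 4" by (simp del: power2_eq_square)
  then show ?thesis by (simp add: basic_tile_def dist_norm cmod_def)
qed

lemma tile_at_size: "tile_at w t \<Longrightarrow> tile_size t = 4 * ratio ^ w"
  using tile_at_similar[of w t] by (auto simp: size_map_tile size_basic)

text \<open>Expresses the foot through \<open>lam\<close> alone, as the positions on a fault line
  require.\<close>

lemma tile_at_foot:
  assumes "tile_at w (A, C, B)"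
  shows "foot C A B = A + (4 / (lam * lam)) *\<^sub>R (B - A)"
proof -
  obtain g f where f: "similarity (ratio ^ w) g f" "(A, C, B) = map_tile f basic"
    using tile_at_similar[OF assms] by blast
  let ?A = "Complex leg_b 0" and ?B = "Complex 0 leg_a"
  have *: "leg_b * (leg_a * leg_a) = leg_b * (16 - leg_b * leg_b)" using legs_sq by simp
  have "foot 0 ?A ?B = ?A + (leg_b * leg_b / 16) *\<^sub>R (?B - ?A)"
    unfolding foot_basic using * by (simp add: complex_eq_iff field_simps)
  then have "f (foot 0 ?A ?B) = f ?A + (4 / (lam * lam)) *\<^sub>R (f ?B - f ?A)"
    unfolding long_leg_projection by (simp only: similarity_affine[OF f(1)])
  then show ?thesis
    using f(2) similarity_foot[OF f(1)] by (simp add: basic_tile_def)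
qed

lemma tile_at_nonempty: "\<exists>t. tile_at w t"
  by (induction w) (metis tile_at.base, metis tile_at.big)

section \<open>The levels \<open>T_n\<close> in terms of the index\<close>

lemma tile_at_Suc_iff:
  "tile_at (Suc n) t \<longleftrightarrow> (\<exists>s. tile_at n s \<and> t = big_daughter s) \<or>
     (\<exists>m s. n = Suc m \<and> tile_at m s \<and> t \<in> small_daughters s)"
  by (subst tile_at.simps) (auto simp: eq_commute)

lemma small_daughters_size:
  assumes "tile_at w t" "u \<in> small_daughters t"
  shows "tile_size u = 4 * ratio ^ Suc (Suc w)"
  using tile_at_size[OF tile_at.small[OF assms]] .

text \<open>The tiles of index \<open>n\<close> are the largest and get subdivided. The second set
  has index \<open>n + 1\<close> and is kept; the big daughters of index \<open>n + 1\<close> join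
  it only at the next level.\<close>

lemma level_tiles_eq:
  "level_tiles leg_a leg_b n = {t. tile_at n t} \<union>
     {t. \<exists>m s. n = Suc m \<and> tile_at m s \<and> t \<in> small_daughters s}"
proof (induction n)
  case 0
  show ?case by (auto intro: tile_at.base elim: tile_at.cases)
next
  case (Suc n)
  let ?L = "level_tiles leg_a leg_b n"
  define X where "X = {t. \<exists>m s. n = Suc m \<and> tile_at m s \<and> t \<in> small_daughters s}"
  note IH = Suc.IH[folded X_def]
  have less: "4 * ratio ^ Suc n < 4 * ratio ^ n"
    using ratio_pos ratio_less_1 by simp
  have L: "tile_size t = 4 * ratio ^ n" if "tile_at n t" for t
    using tile_at_size that by blast
  have S: "tile_size t = 4 * ratio ^ Suc n" if "t \<in> X" for t
    using small_daughters_size that unfolding X_def by blast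
  \<comment> \<open>A witness that the larger of the two sizes really occurs.\<close>
  obtain t0 where t0: "tile_at n t0" using tile_at_nonempty by blast
  have LS: "(tile_at n t \<and> tile_size t = 4 * ratio ^ n) \<or>
      (t \<in> X \<and> tile_size t = 4 * ratio ^ Suc n)" if "t \<in> ?L" for t
    using that L S unfolding IH by blast
  have "t0 \<in> ?L" using t0 unfolding IH by blast
  have "{t \<in> ?L. \<exists>u\<in>?L. tile_size t < tile_size u} = X" (is "?Z = _")
  proof (intro equalityI subsetI)
    fix t assume "t \<in> ?Z"
    then obtain u where u: "t \<in> ?L" "u \<in> ?L" "tile_size t < tile_size u" by blast
    then have "tile_size t < 4 * ratio ^ n" using LS[OF u(2)] less by linarith
    with LS[OF u(1)] show "t \<in> X" by auto
  next
    fix t assume t: "t \<in> X"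
    have "tile_size t < tile_size t0" using S[OF t] L[OF t0] less by linarith
    moreover have "t \<in> ?L" unfolding IH using t by (rule UnI2)
    ultimately show "t \<in> ?Z" using \<open>t0 \<in> ?L\<close> by blast
  qed
  moreover have "{t \<in> ?L. \<forall>u\<in>?L. tile_size u \<le> tile_size t} = {t. tile_at n t}" (is "?Y = _")
  proof (intro equalityI subsetI)
    fix t assume "t \<in> ?Y"
    then have "t \<in> ?L" "tile_size t0 \<le> tile_size t" using \<open>t0 \<in> ?L\<close> by blast+
    with LS[of t] L[OF t0] less show "t \<in> {t. tile_at n t}" by (simp del: power_Suc)
  next
    fix t assume "t \<in> {t. tile_at n t}"
    then have t: "tile_at n t" by simp
    have "tile_size u \<le> tile_size t" if "u \<in> ?L" for u
      using LS[OF that] L[OF t] less by linarith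
    moreover have "t \<in> ?L" unfolding IH using t by blast
    ultimately show "t \<in> ?Y" by blast
  qed
  ultimately have "level_tiles leg_a leg_b (Suc n) = X \<union> \<Union> (subdivide ` {t. tile_at n t})"
    by (simp add: subdivide_largest_def)
  then show ?case
    unfolding X_def subdivide_daughters tile_at_Suc_iff by blast
qed

text \<open>Level 0 is a single tile; two sizes occur from level 1 on.\<close>

lemma level_tiles_sizes:
  "tile_size ` level_tiles leg_a leg_b (Suc n) = {4 * ratio ^ Suc n, 4 * ratio ^ Suc (Suc n)}"
proof -
  obtain s t where s: "tile_at n s" and t: "tile_at (Suc n) t" using tile_at_nonempty by blast
  obtain u where u: "u \<in> small_daughters s" by (cases s) (auto simp: Let_def)
  show ?thesis
  proof (intro equalityI subsetI)
    fix x assume "x \<in> tile_size ` level_tiles leg_a leg_b (Suc n)"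
    then show "x \<in> {4 * ratio ^ Suc n, 4 * ratio ^ Suc (Suc n)}"
      unfolding level_tiles_eq using tile_at_size small_daughters_size by blast
  next
    fix x assume "x \<in> {4 * ratio ^ Suc n, 4 * ratio ^ Suc (Suc n)}"
    then have "x = tile_size t \<or> x = tile_size u"
      by (simp only: tile_at_size[OF t] small_daughters_size[OF s u] insert_iff empty_iff simp_thms)
    then show "x \<in> tile_size ` level_tiles leg_a leg_b (Suc n)"
      unfolding level_tiles_eq using s t u by blast
  qed
qed

section \<open>Tiles rotated by powers of \<open>turn\<close>\<close>

lemma turned_small_daughter:
  assumes "tile_at w s" "similarity (ratio ^ w) g f" "s = map_tile f basic"
  shows "\<exists>t h. t \<in> small_daughters s \<and> similarity (ratio ^ Suc (Suc w)) (g \<circ> (\<lambda>z. turn * z)) h \<and>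
    t = map_tile h basic"
proof -
  obtain h u where h: "similarity (ratio * ratio) (\<lambda>z. turn * z) h" 
      "u \<in> small_daughters basic" "u = map_tile h basic"
    using turned_daughter_basic[of "Complex leg_b 0" 0 "Complex 0 leg_a"]
    by (auto simp: basic_tile_def Let_def)
  have "similarity (ratio ^ Suc (Suc w)) (g \<circ> (\<lambda>z. turn * z)) (f \<circ> h)"
    using similarity_comp[OF assms(2) h(1)] by (simp add: ac_simps)
  moreover have "map_tile f u \<in> small_daughters s"
    using h assms by (simp add: small_daughters_map)
  moreover have "map_tile f u = map_tile (f \<circ> h) basic"
    by (simp add: h(3) map_tile_comp)
  ultimately show ?thesis by blast
qed

text \<open>Take \<open>r + 2 * i\<close> big daughters, whose reflections cancel in pairs, then
  \<open>j\<close> turned small daughters. The padding \<open>i\<close> lets tiles of one index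
  realise many exponents \<open>j\<close>.\<close>

lemma tile_at_orientation:
  "\<exists>t f. tile_at (r + 2 * i + 2 * j) t \<and>
     similarity (ratio ^ (r + 2 * i + 2 * j)) ((mirror ^^ r) \<circ> (\<lambda>z. turn ^ j * z)) f \<and>
     t = map_tile f basic"
proof (induction j)
  case 0
  obtain h where h: "similarity ratio mirror h" "big_daughter basic = map_tile h basic"
    using big_daughter_basic by blast
  have *: "\<exists>t f. tile_at k t \<and> similarity (ratio ^ k) (mirror ^^ k) f \<and> t = map_tile f basic" for k
  proof (induction k)
    case 0
    show ?case using tile_at.base similarity_id map_tile_id by (metis funpow_0 power_0 id_apply ext)
  next
    case (Suc k)
    then obtain t f where t: "tile_at k t" "similarity (ratio ^ k) (mirror ^^ k) f" "t = map_tile f basic"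
      by blast
    have "similarity (ratio ^ Suc k) (mirror ^^ Suc k) (f \<circ> h)"
      using similarity_comp[OF t(2) h(1)] by (simp add: mult.commute flip: funpow_Suc_right funpow.simps)
    moreover have "big_daughter t = map_tile (f \<circ> h) basic"
      by (simp add: t(3) big_daughter_map[OF t(2)] h(2) map_tile_comp)
    ultimately show ?case using tile_at.big[OF t(1)] by blast
  qed
  have "mirror ^^ (2 * i) = id"
    unfolding funpow_mult[symmetric] by (simp add: numeral_2_eq_2 mirror_involution)
  then have "mirror ^^ (r + 2 * i) = mirror ^^ r" by (simp add: funpow_add)
  then show ?case using *[of "r + 2 * i"] by (simp add: comp_def)
next
  case (Suc j)
  let ?w = "r + 2 * i + 2 * j"
  obtain t f where t: "tile_at ?w t"
    "similarity (ratio ^ ?w) ((mirror ^^ r) \<circ> (\<lambda>z. turn ^ j * z)) f" "t = map_tile f basic"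
    using Suc.IH by blast
  from turned_small_daughter[OF t] obtain u h where u: "u \<in> small_daughters t" "u = map_tile h basic"
    "similarity (ratio ^ Suc (Suc ?w)) ((mirror ^^ r) \<circ> (\<lambda>z. turn ^ j * z) \<circ> (\<lambda>z. turn * z)) h"
    by blast
  have "(mirror ^^ r) \<circ> (\<lambda>z. turn ^ j * z) \<circ> (\<lambda>z. turn * z) =
      (mirror ^^ r) \<circ> (\<lambda>z. turn ^ Suc j * z)"
    by (simp add: fun_eq_iff ac_simps)
  moreover have "r + 2 * i + 2 * Suc j = Suc (Suc ?w)" by simp
  ultimately show ?case using tile_at.small[OF t(1) u(1)] u(2,3) by metis
qed

text \<open>The pair \<open>(p, q)\<close> at index \<open>n\<close> satisfies \<open>2 cos (n \<phi>) = p + q y\<close> for \<open>y = 2 cos \<phi>\<close>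
  with \<open>y\<^sup>2 = 4 - y\<close>; having integer coefficients, it also makes sense at the conjugate of \<open>y\<close>.\<close>

fun double_cos_coeffs :: "nat \<Rightarrow> int \<times> int" where
  "double_cos_coeffs 0 = (2, 0)"
| "double_cos_coeffs (Suc 0) = (0, 1)"
| "double_cos_coeffs (Suc (Suc n)) =
    (let (p, q) = double_cos_coeffs (Suc n); (p', q') = double_cos_coeffs n
     in (4 * q - p', p - q - q'))"

definition double_cos :: "real \<Rightarrow> nat \<Rightarrow> real" where
  "double_cos y n = (case double_cos_coeffs n of (p, q) \<Rightarrow> of_int p + of_int q * y)"

text \<open>The recurrence uses only the quadratic equation, so it also holds at the root of modulus
  above 2, which is not of the form \<open>2 cos \<phi>\<close>.\<close>

lemma double_cos_simps:
  "double_cos y 0 = 2" "double_cos y (Suc 0) = y"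
  "y * y = 4 - y \<Longrightarrow> double_cos y (Suc (Suc n)) = y * double_cos y (Suc n) - double_cos y n"
proof -
  show "double_cos y 0 = 2" "double_cos y (Suc 0) = y" by (simp_all add: double_cos_def)
  assume y: "y * y = 4 - y"
  obtain p q p' q' where "double_cos_coeffs (Suc n) = (p, q)" "double_cos_coeffs n = (p', q')"
    by (metis surj_pair)
  moreover have "y * (of_int q * y) = of_int q * (4 - y)" by (simp flip: y)
  ultimately show "double_cos y (Suc (Suc n)) = y * double_cos y (Suc n) - double_cos y n"
    by (simp add: double_cos_def algebra_simps)
qed

text \<open>A unit \<open>u\<close> satisfies \<open>u * u = y * u - 1\<close> for
  \<open>y = 2 * Re u\<close>; hence \<open>2 * Re (u ^ n)\<close> obeys the same
  recurrence.\<close>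

lemma double_cos_unit:
  assumes "norm u = 1" "y = 2 * Re u" "y * y = 4 - y"
  shows "double_cos y n = 2 * Re (u ^ n)"
proof -
  have uu: "Re u * Re u + Im u * Im u = 1"
    using assms(1) by (simp add: cmod_def power2_eq_square)
  have step: "2 * Re (u ^ Suc (Suc n)) = y * (2 * Re (u ^ Suc n)) - 2 * Re (u ^ n)" for n
  proof -
    have "u * u = complex_of_real y * u - 1"
      using uu by (simp add: complex_eq_iff assms(2) algebra_simps)
    then have "(u * u) * u ^ n = complex_of_real y * u ^ Suc n - u ^ n"
      by (simp add: left_diff_distrib mult.assoc)
    then have "u ^ Suc (Suc n) = complex_of_real y * u ^ Suc n - u ^ n"
      by (simp add: mult.assoc)
    then show ?thesis by simp
  qed
  have "double_cos y n = 2 * Re (u ^ n) \<and> double_cos y (Suc n) = 2 * Re (u ^ Suc n)"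
  proof (induction n)
    case 0
    show ?case using assms(2) by (simp add: double_cos_simps)
  next
    case (Suc n)
    then show ?case by (simp only: double_cos_simps(3)[OF assms(3)] step simp_thms)
  qed
  then show ?thesis by blast
qed

text \<open>As long as the moduli do not decrease, the recurrence gives growth by at least
  \<open>5/2 - 1 = 3/2\<close>; monotonicity is therefore carried through the induction.\<close>

lemma double_cos_conj_large:
  assumes "y * y = 4 - y" "y < -5/2"
  shows "2 < \<bar>double_cos y (Suc n)\<bar>"
proof -
  have "\<bar>double_cos y n\<bar> \<le> \<bar>double_cos y (Suc n)\<bar> \<and> 2 < \<bar>double_cos y (Suc n)\<bar>"
  proof (induction n)
    case 0
    show ?case using assms(2) by (simp add: double_cos_simps)
  next
    case (Suc n)
    let ?a = "\<bar>double_cos y (Suc n)\<bar>"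
    have "\<bar>y * double_cos y (Suc n)\<bar> = \<bar>y\<bar> * ?a" by (rule abs_mult)
    moreover have "5/2 * ?a \<le> \<bar>y\<bar> * ?a" using assms(2) by (intro mult_right_mono) auto
    ultimately have "5/2 * ?a - ?a \<le> \<bar>double_cos y (Suc (Suc n))\<bar>"
      using Suc.IH unfolding double_cos_simps(3)[OF assms(1)] by linarith
    then show ?case using Suc.IH by linarith
  qed
  then show ?thesis by blast
qed

text \<open>If the power were 1, the value 2 of \<open>double_cos\<close> at \<open>lam - 1\<close>
  would persist at the conjugate \<open>- lam\<close>, where the modulus exceeds 2.\<close>

lemma turn_power_neq_1: "turn ^ Suc n \<noteq> 1"
proof
  assume "turn ^ Suc n = 1"
  define y where "y = 2 * Re turn"
  have y: "y = lam - 1" by (simp add: y_def turn_def leg_b_lam)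
  have y2: "y * y = 4 - y" using lam_sq by (simp add: y algebra_simps)
  have "double_cos y (Suc n) = 2"
    using double_cos_unit[OF norm_turn y_def y2, of "Suc n"]
    unfolding \<open>turn ^ Suc n = 1\<close> by simp
  moreover obtain p q where pq: "double_cos_coeffs (Suc n) = (p, q)" by fastforce
  ultimately have "of_int (p - q - 2) + of_int q * lam = 0"
    by (simp add: double_cos_def y algebra_simps)
  then have "p - q - 2 = 0 \<and> q = 0" by (rule int_lam_eq_0)
  then have "double_cos (- lam) (Suc n) = 2" by (simp add: double_cos_def pq)
  moreover have "2 < \<bar>double_cos (- lam) (Suc n)\<bar>"
    using lam_sq lam_bounds by (intro double_cos_conj_large) auto
  ultimately show False by simp
qed

lemma turn_power_inj: "inj (\<lambda>j. turn ^ j)"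
proof -
  have "turn \<noteq> 0" using norm_turn by auto
  have *: False if ij: "i < j" and eq: "turn ^ i = turn ^ j" for i j
  proof -
    obtain k where k: "j = i + Suc k" using less_imp_Suc_add[OF ij] by auto
    have "turn ^ j = turn ^ i * turn ^ Suc k" unfolding k by (simp flip: power_add)
    then show False using eq \<open>turn \<noteq> 0\<close> turn_power_neq_1[of k] by simp
  qed
  show ?thesis by (rule injI) (metis * linorder_neqE_nat)
qed

section \<open>Siblings\<close>

text \<open>The line through \<open>o'\<close> orthogonal to \<open>w\<close> weakly separates the
  segments. Common points lie on it, and a segment with an endpoint off the line meets it at most
  once.\<close>

lemma no_share_segment:
  fixes w :: complex
  assumes "0 \<le> (p - o') \<bullet> w" "0 \<le> (q - o') \<bullet> w" "(r - o') \<bullet> w \<le> 0" "(s - o') \<bullet> w \<le> 0"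
    and "(p - o') \<bullet> w \<noteq> 0 \<or> (q - o') \<bullet> w \<noteq> 0 \<or> (r - o') \<bullet> w \<noteq> 0 \<or> (s - o') \<bullet> w \<noteq> 0"
  shows "\<not> share_segment (closed_segment p q) (closed_segment r s)"
proof
  define l where "l = (\<lambda>z. (z - o') \<bullet> w)"
  have l: "(z - o') \<bullet> w = l z" for z by (simp add: l_def)
  note signs = assms[unfolded l]
  have lin: "l (x + t *\<^sub>R (y - x)) = (1 - t) * l x + t * l y" for x y t
    by (simp add: l_def inner_add_left inner_diff_left algebra_simps)
  have seg: "\<exists>t. 0 \<le> t \<and> t \<le> 1 \<and> x = y + t *\<^sub>R (z - y)" if "x \<in> closed_segment y z" for x y z :: complex
    using that by (auto simp: closed_segment_def algebra_simps)
  have nonneg: "0 \<le> l x" if "x \<in> closed_segment p q" for x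
    using seg[OF that] signs by (auto simp: lin)
  have nonpos: "l x \<le> 0" if "x \<in> closed_segment r s" for x
    using seg[OF that] signs by (auto simp: lin mult_nonneg_nonpos add_nonpos_nonpos)
  \<comment> \<open>The sign \<open>k\<close> is 1 for the segment on the nonnegative side and -1
    for the other, so one argument serves both.\<close>
  have unique: "x = y"
    if prems: "x \<in> closed_segment y' z'" "y \<in> closed_segment y' z'" "l x = 0" "l y = 0"
      "0 \<le> k * l y'" "0 \<le> k * l z'" "k * l y' \<noteq> 0 \<or> k * l z' \<noteq> 0" for x y y' z' k
  proof -
    obtain t t' where t: "0 \<le> t" "t \<le> 1" "x = y' + t *\<^sub>R (z' - y')"
      "0 \<le> t'" "t' \<le> 1" "y = y' + t' *\<^sub>R (z' - y')"
      using seg prems(1,2) by meson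
    have "(1 - t) * (k * l y') + t * (k * l z') = k * l x" "(1 - t') * (k * l y') + t' * (k * l z') = k * l y"
      unfolding t(3,6) lin by (simp_all add: algebra_simps)
    then have "(1 - t) * (k * l y') + t * (k * l z') = 0" "(1 - t') * (k * l y') + t' * (k * l z') = 0"
      using prems by simp_all
    moreover have "0 \<le> (1 - t) * (k * l y')" "0 \<le> t * (k * l z')"
      "0 \<le> (1 - t') * (k * l y')" "0 \<le> t' * (k * l z')"
      using t(1,2,4,5) prems(5,6) by (simp_all del: zero_le_mult_iff add: mult_nonneg_nonneg)
    ultimately have "(1 - t) * (k * l y') = 0 \<and> t * (k * l z') = 0"
      "(1 - t') * (k * l y') = 0 \<and> t' * (k * l z') = 0"
      by linarith+
    then have "t = t'" using prems(7) by auto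
    then show ?thesis by (simp add: t)
  qed
  assume "share_segment (closed_segment p q) (closed_segment r s)"
  then obtain x y where xy: "x \<noteq> y" "closed_segment x y \<subseteq> closed_segment p q \<inter> closed_segment r s"
    by (auto simp: share_segment_def)
  then have in': "x \<in> closed_segment p q" "y \<in> closed_segment p q" "x \<in> closed_segment r s" "y \<in> closed_segment r s"
    by auto
  then have "l x = 0" "l y = 0" using nonneg nonpos by (meson order_antisym)+
  then show False
    using unique[of x p q y 1] unique[of x r s y "-1"] in' xy(1) signs
    by auto
qed

text \<open>The right angle at \<open>C\<close> makes \<open>(C - A) \<bullet> (B - A)\<close> equal
  to \<open>|AC|^2\<close>, so the affine parameter of the foot is \<open>(b / c)^2\<close>.\<close>

lemma is_tile_foot:
  assumes "is_tile leg_a leg_b 4 (A, C, B)"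
  shows "foot C A B = A + (4 / (lam * lam)) *\<^sub>R (B - A)"
proof -
  obtain k where k: "k > 0" "dist A C = k * leg_b" "dist A B = k * 4" and o: "(A - C) \<bullet> (B - C) = 0"
    using assms by (auto simp: orthogonal_def)
  have "(C - A) \<bullet> (B - A) = (A - C) \<bullet> (A - C) - (A - C) \<bullet> (B - C)"
    by (simp add: inner_diff_left inner_diff_right inner_commute)
  also have "\<dots> = (k * leg_b)\<^sup>2" using o k(2) by (simp add: dist_norm dot_square_norm)
  finally have 1: "(C - A) \<bullet> (B - A) = (k * leg_b)\<^sup>2" .
  have "(B - A) \<bullet> (B - A) = (k * 4)\<^sup>2"
    using k(3) by (simp add: dist_norm dot_square_norm norm_minus_commute)
  then have "(C - A) \<bullet> (B - A) / ((B - A) \<bullet> (B - A)) = leg_b * leg_b / 16"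
    using k(1) 1 by (simp add: power2_eq_square)
  then show ?thesis by (simp add: foot_def long_leg_projection)
qed

lemma meet_full_edges_commute: "meet_full_edges t u \<longleftrightarrow> meet_full_edges u t"
  unfolding meet_full_edges_def share_segment_def by (metis Int_commute)

lemma sibling_edge_to_edge: "sibling_edge_to_edge leg_a leg_b 4"
  unfolding sibling_edge_to_edge_def
proof (intro allI impI)
  fix p :: tile assume p: "is_tile leg_a leg_b 4 p"
  obtain A C B where ACB: "p = (A, C, B)" by (cases p)
  obtain k where k: "k > 0" "dist A C = k * leg_b" "dist C B = k * leg_a" and o: "(A - C) \<bullet> (B - C) = 0"
    using p by (auto simp: ACB orthogonal_def)
  define P Q where "P = A - C" and "Q = B - C"
  have PQ: "P \<bullet> Q = 0" "Q \<bullet> P = 0" "P \<bullet> P \<noteq> 0" "Q \<bullet> Q \<noteq> 0"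
    using o k leg_a_pos leg_b_pos by (auto simp: P_def Q_def inner_commute)
  \<comment> \<open>Meeting edge to edge is an affine property, so the coordinates \<open>pt\<close> with \<open>A = (1, 0)\<close>, \<open>C = 0\<close>,
    \<open>B = (0, 1)\<close> are used. Two tiles are separated by the line containing their common side; edges
    on that line are separated by a second functional along it.\<close>
  define x where "x = 1 / lam"
  \<comment> \<open>The position of the foot on \<open>AB\<close>: from
    \<open>lam * lam = lam + 4\<close> follows \<open>4 / (lam * lam) = 1 - 1 / lam\<close>.\<close>
  define u where "u = 1 - x"
  have u: "0.6 < u" "u < 0.62"
    using lam_bounds lam_pos by (simp_all add: u_def x_def field_simps)
  have "4 * x * x + x = 1"
    using lam_sq lam_pos by (simp add: x_def field_simps)
  then have ux: "4 / (lam * lam) = u" by (simp add: u_def x_def)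
  define pt where "pt = (\<lambda>s t :: real. C + s *\<^sub>R P + t *\<^sub>R Q)"
  \<comment> \<open>The vector that represents the functional
    \<open>\<alpha> * s + \<beta> * t\<close> in the coordinates \<open>pt\<close>.\<close>
  define fn where "fn = (\<lambda>\<alpha> \<beta>. (\<alpha> / (P \<bullet> P)) *\<^sub>R P + (\<beta> / (Q \<bullet> Q)) *\<^sub>R Q)"
  have fn: "(pt s t - pt s' t') \<bullet> fn \<alpha> \<beta> = \<alpha> * (s - s') + \<beta> * (t - t')" for s t s' t' \<alpha> \<beta>
    using PQ by (simp add: pt_def fn_def inner_add_left inner_add_right inner_diff_left field_simps)
  have sep: "\<not> share_segment (closed_segment (pt s1 t1) (pt s2 t2)) (closed_segment (pt s3 t3) (pt s4 t4))"
    if "0 \<le> \<alpha> * (s1 - s) + \<beta> * (t1 - t)" "0 \<le> \<alpha> * (s2 - s) + \<beta> * (t2 - t)"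
      "\<alpha> * (s3 - s) + \<beta> * (t3 - t) \<le> 0" "\<alpha> * (s4 - s) + \<beta> * (t4 - t) \<le> 0"
      "\<alpha> * (s1 - s) + \<beta> * (t1 - t) \<noteq> 0 \<or> \<alpha> * (s2 - s) + \<beta> * (t2 - t) \<noteq> 0 \<or>
       \<alpha> * (s3 - s) + \<beta> * (t3 - t) \<noteq> 0 \<or> \<alpha> * (s4 - s) + \<beta> * (t4 - t) \<noteq> 0"
    for s1 t1 s2 t2 s3 t3 s4 t4 s t \<alpha> \<beta>
    using no_share_segment[of "pt s1 t1" "pt s t" "fn \<alpha> \<beta>" "pt s2 t2" "pt s3 t3" "pt s4 t4"] that
    unfolding fn by blast
  have mid: "midpoint (pt s t) (pt s' t') = pt ((s + s') / 2) ((t + t') / 2)" for s t s' t'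
    unfolding midpoint_affine
    by (simp add: pt_def complex_eq_iff field_simps)
  have pts: "A = pt 1 0" "C = pt 0 0" "B = pt 0 1"
    by (simp_all add: pt_def P_def Q_def)
  have F: "foot C A B = pt (1 - u) u"
    using is_tile_foot p ux unfolding ACB
    by (simp add: pt_def P_def Q_def algebra_simps)
  define M where "M = pt (1/2) 0"
  define N where "N = pt ((2 - u)/2) (u/2)"
  define K where "K = pt ((1 - u)/2) (u/2)"
  define G where "G = pt (1 - u) u"
  have sub: "subdivide p = {(A, N, M), (M, K, C), (M, K, G), (G, N, M), (C, G, B)}"
    unfolding ACB subdivide.simps Let_def F
    by (simp add: pts mid M_def N_def K_def G_def field_simps)
  have mids: "midpoint A N = pt ((4 - u)/4) (u/4)" "midpoint M K = pt ((2-u)/4) (u/4)"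
    "midpoint G N = pt ((4 - 3 * u)/4) (3*u/4)" "midpoint C G = K"
    by (simp_all add: pts mid M_def N_def K_def G_def field_simps)
  note defs = pts M_def N_def K_def G_def
  \<comment> \<open>The functional \<open>u * (s - 1/2) + (u - 1/2) * t\<close> vanishes on the line
    \<open>MG\<close>, with \<open>A\<close> and \<open>N\<close> on one side, \<open>K\<close> and
    \<open>C\<close> on the other.\<close>
  have "meet_full_edges (A, N, M) (M, K, C)"
    unfolding meet_full_edges_def tile_edges.simps mids
    unfolding defs
    using u by (auto simp: field_simps
        sep[where s = "1/2" and t = 0 and \<alpha> = u and \<beta> = "u - 1/2"])
  moreover have "meet_full_edges (A, N, M) (M, K, G)"
    unfolding meet_full_edges_def tile_edges.simps mids
    unfolding defs
    using u by (auto simp: field_simps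
        sep[where s = "1/2" and t = 0 and \<alpha> = u and \<beta> = "u - 1/2"])
  moreover have "meet_full_edges (G, N, M) (M, K, C)"
    unfolding meet_full_edges_def tile_edges.simps mids
    unfolding defs
    using u by (auto simp: field_simps
        sep[where s = "1/2" and t = 0 and \<alpha> = u and \<beta> = "u - 1/2"])
  moreover have "meet_full_edges (G, N, M) (M, K, G)"
    unfolding meet_full_edges_def tile_edges.simps mids
    unfolding closed_segment_commute[of M G]
    unfolding defs
    using u by (auto simp: field_simps
        sep[where s = "1/2" and t = 0 and \<alpha> = u and \<beta> = "u - 1/2"])
  moreover have "meet_full_edges (A, N, M) (G, N, M)"
    unfolding meet_full_edges_def tile_edges.simps mids
    unfolding defs
    using u by (auto simp: field_simps
        sep[where s = "1/2" and t = 0 and \<alpha> = u and \<beta> = "u - 1"])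
  \<comment> \<open>The line \<open>s + t = 1/2\<close> carries the common long leg
    \<open>MK\<close>; the level \<open>t = u/4\<close> cuts it at its midpoint and so separates the
    halves.\<close>
  moreover have "meet_full_edges (M, K, G) (M, K, C)"
    unfolding meet_full_edges_def tile_edges.simps mids
    unfolding defs
    using u by (auto simp: field_simps
        sep[where s = "1/2" and t = 0 and \<alpha> = 1 and \<beta> = 1]
        sep[where s = 0 and t = "u/4" and \<alpha> = 0 and \<beta> = 1]
        sep[where s = 0 and t = "u/4" and \<alpha> = 0 and \<beta> = "-1"])
  \<comment> \<open>From here on the separating line is \<open>CG\<close>, where
    \<open>u * s + (u - 1) * t\<close> vanishes; the level \<open>t = u/2\<close> cuts it at
    \<open>K\<close>.\<close>
  moreover have "meet_full_edges (A, N, M) (C, G, B)"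
    unfolding meet_full_edges_def tile_edges.simps mids
    unfolding defs
    using u by (auto simp: field_simps
        sep[where s = 0 and t = 0 and \<alpha> = u and \<beta> = "u - 1"])
  moreover have "meet_full_edges (M, K, C) (C, G, B)"
    unfolding meet_full_edges_def tile_edges.simps mids
    unfolding closed_segment_commute[of C K]
    unfolding defs
    using u by (auto simp: field_simps
        sep[where s = 0 and t = 0 and \<alpha> = u and \<beta> = "u - 1"]
        sep[where s = 0 and t = "u/2" and \<alpha> = 0 and \<beta> = 1]
        sep[where s = 0 and t = "u/2" and \<alpha> = 0 and \<beta> = "-1"])
  moreover have "meet_full_edges (M, K, G) (C, G, B)"
    unfolding meet_full_edges_def tile_edges.simps mids
    unfolding defs
    using u by (auto simp: field_simps
        sep[where s = 0 and t = 0 and \<alpha> = u and \<beta> = "u - 1"]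
        sep[where s = 0 and t = "u/2" and \<alpha> = 0 and \<beta> = 1]
        sep[where s = 0 and t = "u/2" and \<alpha> = 0 and \<beta> = "-1"])
  moreover have "meet_full_edges (G, N, M) (C, G, B)"
    unfolding meet_full_edges_def tile_edges.simps mids
    unfolding defs
    using u by (auto simp: field_simps
        sep[where s = 0 and t = 0 and \<alpha> = u and \<beta> = "u - 1"])
  ultimately show "pairwise meet_full_edges (subdivide p)"
    using meet_full_edges_commute pairwise_empty unfolding sub pairwise_insert by blast
qed

section \<open>Fault lines\<close>

text \<open>
  \<open>(h, e, m, k)\<close> encodes a tile with a side on the oriented real line: the hypotenuse \<open>AB\<close> if \<open>h\<close>,
  the long leg \<open>AC\<close> otherwise. Its corner \<open>A\<close> lies at \<open>m + k * lam\<close> and the side extends from there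
  in direction \<open>e = 1\<close> or \<open>e = - 1\<close>. All tiles considered together have the same size, and the unit
  of length is chosen so that the hypotenuse is \<open>lam\<close> and the long leg is \<open>2\<close>. Hence
  \<open>line_daughters\<close>, which lists descendants of size smaller by the factor \<open>1 / lam\<close>, multiplies
  positions by \<open>lam\<close>.
\<close>

type_synonym line_tile = "bool \<times> int \<times> int \<times> int"

fun near_end :: "line_tile \<Rightarrow> real" where
  "near_end (h, e, m, k) = of_int m + of_int k * lam"

text \<open>The conjugate of \<open>near_end\<close> in \<open>\<int>[lam]\<close>.\<close>

fun near_conj :: "line_tile \<Rightarrow> real" where
  "near_conj (h, e, m, k) = of_int m + of_int k * lam_conj"

fun far_end :: "line_tile \<Rightarrow> real" where
  "far_end (h, e, m, k) = of_int m + of_int k * lam + of_int e * (if h then lam else 2)"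

text \<open>Multiplication by \<open>lam\<close> sends \<open>(m, k)\<close> to
  \<open>(4 * k, m + k)\<close>. A hypotenuse \<open>AB\<close> splits into the long legs
  \<open>AN\<close> and \<open>FN\<close> and the hypotenuse \<open>FB\<close> of the big daughter
  of the big daughter; a long leg \<open>AC\<close> splits into the hypotenuses \<open>AM\<close>
  and \<open>MC\<close>.\<close>

fun line_daughters :: "line_tile \<Rightarrow> line_tile set" where
  "line_daughters (True, e, m, k) =
     {(False, e, 4 * k, m + k), (False, - e, 4 * k + 4 * e, m + k), (True, e, 4 * k + 4 * e, m + k)}"
| "line_daughters (False, e, m, k) = {(True, e, 4 * k, m + k), (True, e, 4 * k, m + k + e)}"

fun oriented :: "line_tile \<Rightarrow> bool" where
  "oriented (h, e, m, k) \<longleftrightarrow> e = 1 \<or> e = - 1"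

definition left_end :: "line_tile \<Rightarrow> real" where
  "left_end s = min (near_end s) (far_end s)"

definition right_end :: "line_tile \<Rightarrow> real" where
  "right_end s = max (near_end s) (far_end s)"

definition overlap :: "line_tile \<Rightarrow> line_tile \<Rightarrow> bool" where
  "overlap s t \<longleftrightarrow> left_end s < right_end t \<and> left_end t < right_end s"

lemma left_less_right: "oriented s \<Longrightarrow> left_end s < right_end s"
  using lam_pos by (cases s) (auto simp: left_end_def right_end_def)

lemma line_daughters_oriented:
  assumes "oriented s" "s' \<in> line_daughters s"
  shows "oriented s'"
proof -
  obtain h e m k where "s = (h, e, m, k)" by (cases s)
  then show ?thesis using assms by (cases h) auto
qed

text \<open>The daughters' sides fill the scaled side of the parent:
  \<open>lam * lam = 2 + 2 + lam\<close> for a hypotenuse and \<open>lam * 2 = lam + lam\<close> for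
  a long leg.\<close>

lemma line_daughters_cover:
  assumes "oriented s" "l < r" "left_end s < r" "l < right_end s"
  shows "\<exists>s' \<in> line_daughters s. left_end s' < lam * r \<and> lam * l < right_end s'"
proof -
  obtain h e m k where s: "s = (h, e, m, k)" by (cases s)
  define p where "p = near_end s"
  define q where "q = 4 * of_int k + (of_int m + of_int k) * lam"
  have q: "lam * p = q"
    using arg_cong[OF lam_sq(1), of "\<lambda>z. of_int k * z"]
    by (simp add: p_def q_def s algebra_simps)
  have lr: "lam * l < lam * r" using assms(2) lam_pos by simp
  have scale: "lam * x < lam * y" if "x < y" for x y using that lam_pos by simp
  have e: "e = 1 \<or> e = - 1" using assms(1) by (simp add: s)
  show ?thesis
  proof (cases h)
    case True
    from e show ?thesis
    proof
      assume e: "e = 1"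
      have "p < r" "l < p + lam"
        using assms(3,4) lam_pos by (auto simp: left_end_def right_end_def p_def s e True)
      from this[THEN scale] have "q < lam * r" "lam * l < q + lam + 4"
        by (simp_all add: distrib_left q lam_sq)
      with lr lam_pos have "q < lam * r \<and> lam * l < q + 2 \<or> q + 2 < lam * r \<and> lam * l < q + 4 \<or>
          q + 4 < lam * r \<and> lam * l < q + 4 + lam" by linarith
      then show ?thesis using lam_pos
        by (auto simp: s True e left_end_def right_end_def q_def algebra_simps)
    next
      assume e: "e = - 1"
      have "p - lam < r" "l < p"
        using assms(3,4) lam_pos by (auto simp: left_end_def right_end_def p_def s e True)
      from this[THEN scale] have "q - lam - 4 < lam * r" "lam * l < q"
        by (simp_all add: right_diff_distrib q lam_sq)
      with lr lam_pos have "q - 2 < lam * r \<and> lam * l < q \<or> q - 4 < lam * r \<and> lam * l < q - 2 \<or>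
          q - 4 - lam < lam * r \<and> lam * l < q - 4" by linarith
      then show ?thesis using lam_pos
        by (auto simp: s True e left_end_def right_end_def q_def algebra_simps)
    qed
  next
    case False
    from e show ?thesis
    proof
      assume e: "e = 1"
      have "p < r" "l < p + 2"
        using assms(3,4) by (auto simp: left_end_def right_end_def p_def s e False)
      from this[THEN scale] have "q < lam * r" "lam * l < q + lam * 2"
        by (simp_all add: distrib_left q)
      with lr lam_pos have "q < lam * r \<and> lam * l < q + lam \<or> q + lam < lam * r \<and> lam * l < q + lam * 2"
        by linarith
      then show ?thesis using lam_pos
        by (auto simp: s False e left_end_def right_end_def q_def algebra_simps)
    next
      assume e: "e = - 1"
      have "p - 2 < r" "l < p"
        using assms(3,4) by (auto simp: left_end_def right_end_def p_def s e False)
      from this[THEN scale] have "q - lam * 2 < lam * r" "lam * l < q"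
        by (simp_all add: right_diff_distrib q)
      with lr lam_pos have "q - lam < lam * r \<and> lam * l < q \<or> q - lam * 2 < lam * r \<and> lam * l < q - lam"
        by linarith
      then show ?thesis using lam_pos
        by (auto simp: s False e left_end_def right_end_def q_def algebra_simps)
    qed
  qed
qed

text \<open>The covering is applied twice: to \<open>s\<close> against the interval of
  \<open>t\<close>, then to \<open>t\<close> against the interval of the daughter found, scaled
  back.\<close>

lemma overlap_daughters:
  assumes "oriented s" "oriented t" "overlap s t"
  shows "\<exists>s' \<in> line_daughters s. \<exists>t' \<in> line_daughters t. overlap s' t'"
proof -
  obtain s' where s': "s' \<in> line_daughters s" "left_end s' < lam * right_end t"
      "lam * left_end t < right_end s'"
    using line_daughters_cover[OF assms(1) left_less_right[OF assms(2)]] assms(3)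
    by (auto simp: overlap_def)
  have "left_end s' / lam < right_end s' / lam"
    using left_less_right[OF line_daughters_oriented[OF assms(1) s'(1)]] lam_pos
    by (simp add: divide_strict_right_mono)
  moreover have "left_end t < right_end s' / lam" "left_end s' / lam < right_end t"
    using s'(2,3) lam_pos by (simp_all add: field_simps)
  ultimately obtain t' where "t' \<in> line_daughters t" "left_end t' < right_end s'" "left_end s' < right_end t'"
    using line_daughters_cover[OF assms(2), of "left_end s' / lam" "right_end s' / lam"] lam_pos by auto
  with s'(1) show ?thesis by (auto simp: overlap_def)
qed

text \<open>Conjugation respects the ring operations; the translations that occur are 0 or, up to
  sign, 4 or \<open>lam_conj\<close>.\<close>

lemma near_conj_daughter:
  assumes "oriented s" "s' \<in> line_daughters s"
  shows "\<bar>near_conj s' - lam_conj * near_conj s\<bar> \<le> 4"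
proof -
  obtain h e m k where s: "s = (h, e, m, k)" by (cases s)
  have "lam_conj * near_conj s = 4 * of_int k + (of_int m + of_int k) * lam_conj"
    using arg_cong[OF lam_sq(2), of "\<lambda>z. of_int k * z"] by (simp add: s algebra_simps)
  then show ?thesis using assms lam_bounds unfolding s
    by (cases h) (auto simp: abs_le_iff algebra_simps)
qed

text \<open>
  The two tiles at step 0 have the same hypotenuse with opposite orientations, like the daughters
  \<open>(M, K, F)\<close> and \<open>(F, N, M)\<close>. Since \<open>\<bar>lam_conj\<bar> > 1\<close>, the conjugate of an offset grows forever once it
  is large; four steps suffice to reach a large one.
\<close>

inductive fault_pair :: "nat \<Rightarrow> line_tile \<Rightarrow> line_tile \<Rightarrow> bool" where
  start: "fault_pair 0 (True, 1, 0, 0) (True, - 1, 0, 1)"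
| step: "fault_pair n s t \<Longrightarrow> s' \<in> line_daughters s \<Longrightarrow> t' \<in> line_daughters t \<Longrightarrow>
    fault_pair (Suc n) s' t'"

text \<open>The conjugate offset of this pair is \<open>- 8 + 5 * lam_conj\<close>, of modulus above
  15.8, where the growth estimate takes hold.\<close>

lemma fault_pair_4: "fault_pair 4 (True, - 1, 16, 20) (True, 1, 24, 15)"
proof -
  note fault_pair.start
  then have "fault_pair (Suc 0) (False, - 1, 4, 0) (False, 1, 0, 1)" by (rule fault_pair.step) auto
  then have "fault_pair (Suc (Suc 0)) (True, - 1, 0, 4) (True, 1, 4, 2)" by (rule fault_pair.step) auto
  then have "fault_pair (Suc (Suc (Suc 0))) (False, - 1, 16, 4) (False, 1, 8, 6)" by (rule fault_pair.step) auto
  then have "fault_pair (Suc (Suc (Suc (Suc 0)))) (True, - 1, 16, 20) (True, 1, 24, 15)"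
    by (rule fault_pair.step) auto
  then show ?thesis by (simp add: numeral_eq_Suc)
qed

text \<open>A step multiplies the conjugate offset by more than 1.56 in modulus and shifts it by at
  most 8, that is 4 per tile; \<open>1.56 * x - 8\<close> is at least \<open>x + 1/2\<close> once
  \<open>x\<close> is at least 15.5.\<close>

lemma fault_pair_offsets:
  "\<exists>s t. fault_pair (n + 4) s t \<and> oriented s \<and> oriented t \<and> overlap s t \<and>
     15.5 + n / 2 \<le> \<bar>near_conj s - near_conj t\<bar>"
proof (induction n)
  case 0
  have "overlap (True, - 1, 16, 20) (True, 1, 24, 15)"
    using lam_bounds by (auto simp: overlap_def left_end_def right_end_def)
  with fault_pair_4 lam_bounds show ?case
    by (intro exI[of _ "(True, - 1, 16, 20)"] exI[of _ "(True, 1, 24, 15)"]) auto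
next
  case (Suc n)
  then obtain s t where st: "fault_pair (n + 4) s t" "oriented s" "oriented t" "overlap s t"
    "15.5 + n / 2 \<le> \<bar>near_conj s - near_conj t\<bar>" by blast
  then obtain s' t' where s't': "s' \<in> line_daughters s" "t' \<in> line_daughters t" "overlap s' t'"
    using overlap_daughters by blast
  let ?d = "near_conj s - near_conj t"
  have "\<bar>lam_conj * ?d\<bar> - 8 \<le> \<bar>near_conj s' - near_conj t'\<bar>"
    using near_conj_daughter[OF st(2) s't'(1)] near_conj_daughter[OF st(3) s't'(2)]
    unfolding right_diff_distrib by linarith
  moreover have "1.56 * \<bar>?d\<bar> \<le> \<bar>lam_conj * ?d\<bar>"
    unfolding abs_mult using lam_bounds by (intro mult_right_mono) auto
  ultimately have "15.5 + Suc n / 2 \<le> \<bar>near_conj s' - near_conj t'\<bar>"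
    using st(5) by (simp add: field_simps)
  moreover have "fault_pair (Suc n + 4) s' t'" using fault_pair.step[OF st(1) s't'(1,2)] by simp
  ultimately show ?case using s't' st(2,3) line_daughters_oriented by blast
qed

section \<open>Line tiles realised in the plane\<close>

text \<open>The real line enters the plane by the origin \<open>o'\<close> and the unit vector of
  measurement \<open>v\<close>. Only the two corners on the line are prescribed, so tiles on either
  side of it are covered.\<close>

fun placed :: "complex \<Rightarrow> complex \<Rightarrow> line_tile \<Rightarrow> tile \<Rightarrow> bool" where
  "placed o' v s (A, C, B) \<longleftrightarrow> A = o' + near_end s *\<^sub>R v \<and>
     (if fst s then B else C) = o' + far_end s *\<^sub>R v"

lemma placed_map:
  assumes "similarity r g f" "placed o' v s t"
  shows "placed (f o') (r *\<^sub>R g v) s (map_tile f t)"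
proof -
  obtain w where w: "linear g" "f = (\<lambda>x. r *\<^sub>R g x + w)"
    using assms by (metis similarityE)
  have "f (o' + c *\<^sub>R v) = f o' + c *\<^sub>R r *\<^sub>R g v" for c
    by (simp add: w linear_add[OF w(1)] linear_scale[OF w(1)] algebra_simps)
  with assms(2) show ?thesis by (cases t) auto
qed

text \<open>Coordinates grow by \<open>lam\<close> while \<open>v\<close> shrinks by
  \<open>1 / lam\<close>, so points stay where they are; two steps of the index give the same
  factor.\<close>

lemma placed_daughter:
  assumes "tile_at w t" "placed o' v s t" "s' \<in> line_daughters s"
  shows "\<exists>t'. tile_at (w + 2) t' \<and> placed o' ((1 / lam) *\<^sub>R v) s' t'"
proof -
  obtain A C B where t: "t = (A, C, B)" by (cases t)
  obtain h e m k where s: "s = (h, e, m, k)" by (cases s)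
  define p where "p = near_end s"
  have q: "of_int m + of_int k * lam = p" by (simp add: p_def s)
  have q': "4 * of_int k + (of_int m + of_int k) * lam = lam * p"
    using arg_cong[OF lam_sq(1), of "\<lambda>z. of_int k * z"]
    by (simp add: p_def s algebra_simps)
  have A: "A = o' + p *\<^sub>R v" using assms(2) by (simp add: t p_def)
  define F where "F = foot C A B"
  have F: "F = A + (4 / (lam * lam)) *\<^sub>R (B - A)"
    unfolding F_def using tile_at_foot assms(1) t by blast
  have small: "tile_at (w + 2) (A, midpoint A F, midpoint A C)" 
    "tile_at (w + 2) (midpoint A C, midpoint F C, C)" "tile_at (w + 2) (F, midpoint A F, midpoint A C)"
    using tile_at.small[OF assms(1)] by (auto simp: t Let_def F_def)
  have placedI: "placed o' ((1 / lam) *\<^sub>R v) s' (A', C', B')"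
    if "A' = o' + \<alpha> *\<^sub>R v" "(if fst s' then B' else C') = o' + \<beta> *\<^sub>R v"
      "near_end s' = lam * \<alpha>" "far_end s' = lam * \<beta>" for A' C' B' \<alpha> \<beta>
    using that lam_pos by simp
  have elam: "lam * (lam * of_int e) = lam * of_int e + of_int e * 4"
    using arg_cong[OF lam_sq(1), of "\<lambda>z. z * of_int e"] by (simp add: algebra_simps)
  have lin: "(o' + x *\<^sub>R v) + c *\<^sub>R ((o' + y *\<^sub>R v) - (o' + x *\<^sub>R v)) = o' + (x + c * (y - x)) *\<^sub>R v"
    for x y c by (simp add: algebra_simps)
  show ?thesis
  proof (cases h)
    case True
    have B: "B = o' + (p + of_int e * lam) *\<^sub>R v"
      using assms(2) by (simp add: t s True p_def)
    have F': "F = o' + (p + 4 * of_int e / lam) *\<^sub>R v"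
      using lam_pos unfolding F A B lin by simp
    have N: "midpoint A F = o' + (p + 2 * of_int e / lam) *\<^sub>R v"
      unfolding midpoint_affine F' A lin by simp
    \<comment> \<open>The big daughter of the big daughter is the descendant of index
      \<open>w + 2\<close> with hypotenuse \<open>FB\<close>.\<close>
    obtain H where H: "tile_at (w + 2) (F, H, B)"
      using tile_at.big[OF tile_at.big[OF assms(1)]] by (auto simp: t F_def)
    consider "s' = (False, e, 4 * k, m + k)" | "s' = (False, - e, 4 * k + 4 * e, m + k)"
      | "s' = (True, e, 4 * k + 4 * e, m + k)"
      using assms(3) by (auto simp: s True)
    then show ?thesis
    proof cases
      case 1
      have "placed o' ((1 / lam) *\<^sub>R v) s' (A, midpoint A F, midpoint A C)"
        using q' lam_pos by (intro placedI[OF A, where \<beta> = "p + 2 * of_int e / lam"])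
          (auto simp: 1 N field_simps elam)
      with small show ?thesis by blast
    next
      case 2
      have "placed o' ((1 / lam) *\<^sub>R v) s' (F, midpoint A F, midpoint A C)"
        using q' lam_pos by (intro placedI[OF F', where \<beta> = "p + 2 * of_int e / lam"])
          (auto simp: 2 N field_simps elam)
      with small show ?thesis by blast
    next
      case 3
      have "placed o' ((1 / lam) *\<^sub>R v) s' (F, H, B)"
        using q' lam_pos by (intro placedI[OF F', where \<beta> = "p + of_int e * lam"])
          (auto simp: 3 B field_simps elam)
      with H show ?thesis by blast
    qed
  next
    case False
    have C: "C = o' + (p + 2 * of_int e) *\<^sub>R v"
      using assms(2) by (simp add: t s False p_def mult.commute)
    have M: "midpoint A C = o' + (p + of_int e) *\<^sub>R v"
      unfolding midpoint_affine C A lin by simp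
    consider "s' = (True, e, 4 * k, m + k)" | "s' = (True, e, 4 * k, m + k + e)"
      using assms(3) by (auto simp: s False)
    then show ?thesis
    proof cases
      case 1
      have "placed o' ((1 / lam) *\<^sub>R v) s' (A, midpoint A F, midpoint A C)"
        using q' lam_pos by (intro placedI[OF A, where \<beta> = "p + of_int e"])
          (auto simp: 1 M field_simps elam)
      with small show ?thesis by blast
    next
      case 2
      have "placed o' ((1 / lam) *\<^sub>R v) s' (midpoint A C, midpoint F C, C)"
        using q' lam_pos by (intro placedI[OF M, where \<beta> = "p + 2 * of_int e"])
          (auto simp: 2 C field_simps elam)
      with small show ?thesis by blast
    qed
  qed
qed

text \<open>The fault line is the segment \<open>MF\<close> in a tile of index \<open>w\<close>; the
  free \<open>w\<close> allows any sufficiently high index to be reached.\<close>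

lemma fault_pair_realised:
  assumes "fault_pair n s t"
  shows "\<exists>o' v t1 t2. tile_at (w + 2 + 2 * n) t1 \<and> tile_at (w + 2 + 2 * n) t2 \<and>
     placed o' v s t1 \<and> placed o' v t t2 \<and> norm v = 4 * ratio ^ (w + 2 + 2 * n) / lam"
  using assms
proof induction
  case start
  obtain A C B where P: "tile_at w (A, C, B)" using tile_at_nonempty by (metis surj_pair)
  define F where "F = foot C A B"
  define M where "M = midpoint A C"
  have small: "tile_at (w + 2) (M, midpoint F C, F)" "tile_at (w + 2) (F, midpoint A F, M)"
    using tile_at.small[OF P] by (auto simp: Let_def F_def M_def)
  let ?v = "(1 / lam) *\<^sub>R (F - M)"
  have "norm (F - M) = 4 * ratio ^ (w + 2)"
    using tile_at_size[OF small(2)] by (simp add: dist_norm)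
  then have "norm ?v = 4 * ratio ^ (w + 2) / lam" using lam_pos by simp
  moreover have "placed M ?v (True, 1, 0, 0) (M, midpoint F C, F)"
    "placed M ?v (True, - 1, 0, 1) (F, midpoint A F, M)"
    using lam_pos by simp_all
  ultimately show ?case using small unfolding mult_0_right add_0_right by blast
next
  case (step n s t s' t')
  then obtain o' v t1 t2 where *: "tile_at (w + 2 + 2 * n) t1" "tile_at (w + 2 + 2 * n) t2"
    "placed o' v s t1" "placed o' v t t2" "norm v = 4 * ratio ^ (w + 2 + 2 * n) / lam" by blast
  obtain t1' t2' where **: "tile_at (w + 2 + 2 * n + 2) t1'" "placed o' ((1 / lam) *\<^sub>R v) s' t1'"
    "tile_at (w + 2 + 2 * n + 2) t2'" "placed o' ((1 / lam) *\<^sub>R v) t' t2'"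
    using placed_daughter[OF *(1,3) step.hyps(2)] placed_daughter[OF *(2,4) step.hyps(3)] by blast
  have "norm ((1 / lam) *\<^sub>R v) = 4 * (ratio * ratio * ratio ^ (w + 2 + 2 * n)) / lam"
    unfolding ratio_sq(2) using lam_pos *(5) by simp
  also have "\<dots> = 4 * ratio ^ (w + 2 + 2 * Suc n) / lam" by (simp add: ac_simps)
  finally have "norm ((1 / lam) *\<^sub>R v) = 4 * ratio ^ (w + 2 + 2 * Suc n) / lam" .
  moreover have "w + 2 + 2 * n + 2 = w + 2 + 2 * Suc n" by simp
  ultimately show ?case using ** by metis
qed

section \<open>Shared boundary segments\<close>

text \<open>With \<open>n\<close> normal to \<open>PQ\<close> and pointing away from
  \<open>R\<close>, the triangle lies in a half-plane that a point of \<open>PQ\<close> leaves under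
  any small shift along \<open>n\<close>.\<close>

lemma segment_frontier_triangle:
  fixes P Q R :: complex
  assumes "P \<noteq> Q"
  shows "closed_segment P Q \<subseteq> frontier (convex hull {P, Q, R})"
proof
  fix z assume z: "z \<in> closed_segment P Q"
  define n0 where "n0 = \<i> * (P - Q)"
  define n where "n = (if (R - P) \<bullet> n0 \<le> 0 then n0 else - n0)"
  have n0: "n0 \<noteq> 0" "(P - Q) \<bullet> n0 = 0"
    using assms by (simp_all add: n0_def inner_complex_def algebra_simps)
  have n: "n \<noteq> 0" "(P - Q) \<bullet> n = 0" "(R - P) \<bullet> n \<le> 0"
    using n0 by (simp_all add: n_def)
  have n': "n \<bullet> Q = n \<bullet> P" "n \<bullet> R \<le> n \<bullet> P"
    using n(2,3) by (simp_all add: inner_diff_left inner_commute[of n])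
  have hull: "convex hull {P, Q, R} \<subseteq> {x. n \<bullet> x \<le> n \<bullet> P}"
    using n' by (intro hull_minimal convex_halfspace_le) auto
  have "closed_segment P Q \<subseteq> convex hull {P, Q, R}"
    unfolding segment_convex_hull by (rule hull_mono) auto
  with z have zh: "z \<in> convex hull {P, Q, R}" by blast
  have "closed_segment P Q \<subseteq> {x. n \<bullet> x = n \<bullet> P}"
    using n' by (intro closed_segment_subset convex_hyperplane) auto
  with z have zn: "n \<bullet> z = n \<bullet> P" by blast
  have "z \<notin> interior (convex hull {P, Q, R})"
  proof
    assume "z \<in> interior (convex hull {P, Q, R})"
    then obtain e where e: "e > 0" "ball z e \<subseteq> convex hull {P, Q, R}" by (meson mem_interior)
    define x where "x = z + (e / 2 / norm n) *\<^sub>R n"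
    have "x \<in> ball z e" using e n(1) by (simp add: x_def dist_norm)
    then have "n \<bullet> x \<le> n \<bullet> P" using e(2) hull by blast
    moreover have "n \<bullet> x > n \<bullet> z" using e(1) n(1) by (simp add: x_def inner_add_right)
    ultimately show False using zn by simp
  qed
  then show "z \<in> frontier (convex hull {P, Q, R})"
    unfolding frontier_def using zh closure_subset by blast
qed

lemma in_line_segment:
  assumes "min a b \<le> c" "c \<le> max a b"
  shows "o' + c *\<^sub>R v \<in> closed_segment (o' + a *\<^sub>R v) (o' + b *\<^sub>R (v :: complex))"
proof -
  have "c \<in> closed_segment a b"
    using assms by (auto simp: closed_segment_eq_real_ivl min_def max_def split: if_splits)
  then obtain u where u: "0 \<le> u" "u \<le> 1" "c = (1 - u) * a + u * b"
    by (auto simp: closed_segment_def)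
  have "o' + c *\<^sub>R v = (1 - u) *\<^sub>R (o' + a *\<^sub>R v) + u *\<^sub>R (o' + b *\<^sub>R v)"
    unfolding u(3) by (simp add: algebra_simps)
  with u(1,2) show ?thesis unfolding closed_segment_def by blast
qed

lemma placed_frontier:
  assumes "placed o' v s t" "v \<noteq> 0" "oriented s"
  shows "left_end s \<le> c \<Longrightarrow> c \<le> right_end s \<Longrightarrow> o' + c *\<^sub>R v \<in> frontier (tile_region t)"
proof -
  assume c: "left_end s \<le> c" "c \<le> right_end s"
  obtain A C B where t: "t = (A, C, B)" by (cases t)
  define X where "X = (if fst s then B else C)"
  have AX: "A = o' + near_end s *\<^sub>R v" "X = o' + far_end s *\<^sub>R v"
    using assms(1) by (simp_all add: t X_def)
  have "near_end s \<noteq> far_end s"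
    using left_less_right[OF assms(3)] by (auto simp: left_end_def right_end_def)
  then have "A \<noteq> X" using assms(2) by (simp add: AX)
  then have "closed_segment A X \<subseteq> frontier (convex hull {A, C, B})"
    using segment_frontier_triangle[of A X "if fst s then C else B"]
    by (auto simp: X_def insert_commute split: if_splits)
  moreover have "o' + c *\<^sub>R v \<in> closed_segment A X"
    unfolding AX using c by (intro in_line_segment) (auto simp: left_end_def right_end_def)
  ultimately show ?thesis unfolding t by auto
qed

lemma placed_share_segment:
  assumes "placed o' v s t" "placed o' v s' t'" "v \<noteq> 0" "oriented s" "oriented s'" "overlap s s'"
  shows "share_segment (frontier (tile_region t)) (frontier (tile_region t'))"
proof -
  define l where "l = max (left_end s) (left_end s')"
  define r where "r = min (right_end s) (right_end s')"
  have "l < r" using assms left_less_right by (auto simp: l_def r_def overlap_def)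
  have seg: "o' + ((1 - u) * l + u * r) *\<^sub>R v \<in> frontier (tile_region t) \<inter> frontier (tile_region t')"
    if "0 \<le> u" "u \<le> 1" for u
  proof -
    have "l \<le> (1 - u) * l + u * r" "(1 - u) * l + u * r \<le> r"
      using mult_left_mono[of l r u] mult_left_mono[of l r "1 - u"] that \<open>l < r\<close>
      by (simp_all add: algebra_simps)
    then show ?thesis
      using placed_frontier[OF assms(1,3,4)] placed_frontier[OF assms(2,3,5)]
      by (simp add: l_def r_def)
  qed
  show ?thesis unfolding share_segment_def
  proof (intro exI conjI)
    show "o' + l *\<^sub>R v \<noteq> o' + r *\<^sub>R v" using \<open>l < r\<close> assms(3) by simp
    show "closed_segment (o' + l *\<^sub>R v) (o' + r *\<^sub>R v) \<subseteq>
        frontier (tile_region t) \<inter> frontier (tile_region t')"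
    proof
      fix z assume "z \<in> closed_segment (o' + l *\<^sub>R v) (o' + r *\<^sub>R v)"
      then obtain u where u: "0 \<le> u" "u \<le> 1"
        "z = (1 - u) *\<^sub>R (o' + l *\<^sub>R v) + u *\<^sub>R (o' + r *\<^sub>R v)"
        by (auto simp: closed_segment_def)
      then have "z = o' + ((1 - u) * l + u * r) *\<^sub>R v" by (simp add: algebra_simps)
      with seg[OF u(1,2)] show "z \<in> frontier (tile_region t) \<inter> frontier (tile_region t')" by simp
    qed
  qed
qed

section \<open>Hierarchical tilings\<close>

text \<open>Each supertile of positive order has the sizes \<open>L\<close> and
  \<open>ratio * L\<close>; inclusion of one such pair of sizes in another forces equality, so all
  supertiles share \<open>L\<close>.\<close>

lemma hierarchical_supertiles:
  assumes "hierarchical_tiling leg_a leg_b \<T>"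
  shows "\<exists>L>0. tile_size ` \<T> = {L, ratio * L} \<and>
    (\<forall>n. \<exists>N r g f. n \<le> N \<and> similarity r g f \<and>
       map_tile f ` level_tiles leg_a leg_b N \<subseteq> \<T> \<and> r * (4 * ratio ^ N) = L)"
proof -
  obtain S N where S: "\<T> = (\<Union>i. S i)" "\<And>i. supertile leg_a leg_b (N i) (S i)"
      "\<And>i. S i \<subset> S (Suc i)" "\<And>i. N i < N (Suc i)"
    using assms unfolding hierarchical_tiling_def by blast
  have "strict_mono N" using S(4) by (simp add: strict_mono_Suc_iff)
  then have N: "i \<le> N i" for i by (rule strict_mono_imp_increasing)
  \<comment> \<open>The index starts at \<open>Suc i\<close> to ensure a positive order, hence two
    sizes.\<close>
  have "\<exists>L>0. tile_size ` S (Suc i) = {L, ratio * L} \<and> (\<exists>r g f. similarity r g f \<and>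
      S (Suc i) = map_tile f ` level_tiles leg_a leg_b (N (Suc i)) \<and> r * (4 * ratio ^ N (Suc i)) = L)" for i
  proof -
    obtain e s where es: "euclidean_motion e" "rescaling s"
        "S (Suc i) = map_tile (e \<circ> s) ` level_tiles leg_a leg_b (N (Suc i))"
      using S(2)[of "Suc i"] unfolding supertile_def by blast
    obtain r g where f: "similarity r g (e \<circ> s)"
      using motion_rescaling_similarity[OF es(1,2)] .
    obtain n where n: "N (Suc i) = Suc n" using N[of "Suc i"] by (cases "N (Suc i)") auto
    have "tile_size ` S (Suc i) = (\<lambda>x. r * x) ` (tile_size ` level_tiles leg_a leg_b (N (Suc i)))"
      unfolding es(3) image_image size_map_tile[OF f] by simp
    also have "\<dots> = {r * (4 * ratio ^ N (Suc i)), ratio * (r * (4 * ratio ^ N (Suc i)))}"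
      unfolding n level_tiles_sizes by (simp add: ac_simps)
    finally have "tile_size ` S (Suc i) = {r * (4 * ratio ^ N (Suc i)), ratio * (r * (4 * ratio ^ N (Suc i)))}" .
    moreover have "r * (4 * ratio ^ N (Suc i)) > 0" using f ratio_pos by (simp add: similarity_def)
    ultimately show ?thesis using f es(3) by blast
  qed
  then obtain L where L: "\<And>i. L i > 0" "\<And>i. tile_size ` S (Suc i) = {L i, ratio * L i}"
    "\<And>i. \<exists>r g f. similarity r g f \<and>
      S (Suc i) = map_tile f ` level_tiles leg_a leg_b (N (Suc i)) \<and> r * (4 * ratio ^ N (Suc i)) = L i"
    by metis
  have less: "ratio * L i < L i" for i using L(1)[of i] ratio_less_1 by simp
  have "L (Suc i) = L i" for i
  proof -
    have "{L i, ratio * L i} \<subseteq> {L (Suc i), ratio * L (Suc i)}"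
      unfolding L(2)[symmetric] using S(3) by (intro image_mono) blast
    then consider "L i = L (Suc i)" | "L i = ratio * L (Suc i)" "ratio * L i = ratio * L (Suc i)"
      | "ratio * L i = L (Suc i)" "L i = ratio * L (Suc i)"
      by auto
    then show ?thesis
    proof cases
      case 3
      then show ?thesis using less[of i] less[of "Suc i"] by linarith
    qed (use ratio_pos in auto)
  qed
  then have L0: "L i = L 0" for i by (induction i) auto
  have "\<T> = (\<Union>i. S (Suc i))" using S(1,3) by blast
  moreover have SL: "tile_size ` S (Suc i) = {L 0, ratio * L 0}" for i
    using L(2)[of i] unfolding L0[of i] .
  ultimately have "tile_size ` \<T> = {L 0, ratio * L 0}"
    by (simp only: image_UN SL) simp
  moreover have "\<exists>N r g f. n \<le> N \<and> similarity r g f \<and>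
       map_tile f ` level_tiles leg_a leg_b N \<subseteq> \<T> \<and> r * (4 * ratio ^ N) = L 0" for n
  proof -
    obtain r g f where *: "similarity r g f" "S (Suc n) = map_tile f ` level_tiles leg_a leg_b (N (Suc n))"
      "r * (4 * ratio ^ N (Suc n)) = L n" using L(3) by blast
    have "map_tile f ` level_tiles leg_a leg_b (N (Suc n)) \<subseteq> \<T>"
      using S(1) unfolding *(2)[symmetric] by blast
    moreover have "n \<le> N (Suc n)" using N[of "Suc n"] by simp
    moreover have "r * (4 * ratio ^ N (Suc n)) = L 0" using *(3) L0[of n] by (rule trans)
    ultimately show ?thesis using *(1) by blast
  qed
  ultimately show ?thesis using L(1)[of 0] by blast
qed

section \<open>Infinitely many orientations in each size\<close>

lemma similarity_orientation:
  "similarity r g f \<Longrightarrow> has_orientation leg_a leg_b (map_tile f basic) g"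
  unfolding similarity_def has_orientation_def by blast

text \<open>The map \<open>h\<close> is the reflection left over by the parity of \<open>N\<close>,
  the same for all \<open>j\<close>.\<close>

lemma level_tiles_orientations:
  assumes "2 * n \<le> N"
  shows "\<exists>h. inj h \<and> (\<forall>j\<le>n. \<exists>t \<in> level_tiles leg_a leg_b N. \<exists>f.
    similarity (ratio ^ N) (h \<circ> (\<lambda>z. turn ^ j * z)) f \<and> t = map_tile f basic)"
proof (intro exI conjI allI impI)
  have "inj mirror" by (rule orthogonal_transformation_inj[OF orthogonal_mirror])
  then show "inj (mirror ^^ (N mod 2))" by (rule inj_fn)
  fix j assume "j \<le> n"
  then have "N mod 2 + 2 * (N div 2 - j) + 2 * j = N" using assms by presburger
  then show "\<exists>t \<in> level_tiles leg_a leg_b N. \<exists>f.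
    similarity (ratio ^ N) ((mirror ^^ (N mod 2)) \<circ> (\<lambda>z. turn ^ j * z)) f \<and> t = map_tile f basic"
    using tile_at_orientation[of "N mod 2" "N div 2 - j" j] unfolding level_tiles_eq by auto
qed

text \<open>The smaller tiles are turned daughters of tiles of index \<open>N - 1\<close>; the
  additional rotation commutes with the others and is absorbed into \<open>h\<close>.\<close>

lemma level_tiles_small_orientations:
  assumes "2 * n < N"
  shows "\<exists>h. inj h \<and> (\<forall>j\<le>n. \<exists>t \<in> level_tiles leg_a leg_b N. \<exists>f.
    similarity (ratio ^ Suc N) (h \<circ> (\<lambda>z. turn ^ j * z)) f \<and> t = map_tile f basic)"
proof (intro exI conjI allI impI)
  define M where "M = N - 1"
  have N: "N = Suc M" using assms by (simp add: M_def)
  have "inj mirror" by (rule orthogonal_transformation_inj[OF orthogonal_mirror])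
  then have "inj (mirror ^^ (M mod 2))" by (rule inj_fn)
  moreover have "inj (\<lambda>z. turn * z)"
    by (rule orthogonal_transformation_inj[OF orthogonal_transformation_mult[OF norm_turn]])
  ultimately show "inj ((mirror ^^ (M mod 2)) \<circ> (\<lambda>z. turn * z))" by (rule inj_compose)
  fix j assume "j \<le> n"
  then have "M mod 2 + 2 * (M div 2 - j) + 2 * j = M" using assms N by presburger
  then obtain s f where s: "tile_at M s"
    "similarity (ratio ^ M) ((mirror ^^ (M mod 2)) \<circ> (\<lambda>z. turn ^ j * z)) f" "s = map_tile f basic"
    using tile_at_orientation[of "M mod 2" "M div 2 - j" j] by auto
  then obtain t h where t: "t \<in> small_daughters s" "t = map_tile h basic"
    "similarity (ratio ^ Suc (Suc M)) ((mirror ^^ (M mod 2)) \<circ> (\<lambda>z. turn ^ j * z) \<circ> (\<lambda>z. turn * z)) h"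
    using turned_small_daughter[OF s] by blast
  have "(mirror ^^ (M mod 2)) \<circ> (\<lambda>z. turn ^ j * z) \<circ> (\<lambda>z. turn * z) =
      (mirror ^^ (M mod 2)) \<circ> (\<lambda>z. turn * z) \<circ> (\<lambda>z. turn ^ j * z)"
    by (simp add: fun_eq_iff ac_simps)
  moreover have "t \<in> level_tiles leg_a leg_b N"
    unfolding level_tiles_eq using s(1) t(1) N by blast
  ultimately show "\<exists>t \<in> level_tiles leg_a leg_b N. \<exists>f. similarity (ratio ^ Suc N)
      ((mirror ^^ (M mod 2)) \<circ> (\<lambda>z. turn * z) \<circ> (\<lambda>z. turn ^ j * z)) f \<and> t = map_tile f basic"
    using t(2,3) N by metis
qed

text \<open>Evaluation at 1 separates the exponents, so \<open>n = card G\<close> already yields too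
  many elements; \<open>h\<close> may vary with \<open>n\<close>.\<close>

lemma infinite_rotations:
  assumes "\<And>n. \<exists>h. inj h \<and> (\<forall>j\<le>n. h \<circ> (\<lambda>z. turn ^ j * z) \<in> G)"
  shows "infinite G"
proof
  assume "finite G"
  obtain h where h: "inj h" "\<forall>j\<le>card G. h \<circ> (\<lambda>z. turn ^ j * z) \<in> G"
    using assms[of "card G"] by blast
  have "inj_on (\<lambda>j. h \<circ> (\<lambda>z. turn ^ j * z)) {..card G}"
  proof (rule inj_onI)
    fix i j assume "h \<circ> (\<lambda>z. turn ^ i * z) = h \<circ> (\<lambda>z. turn ^ j * z)"
    from fun_cong[OF this, of 1] have "turn ^ i = turn ^ j" using h(1) by (simp add: inj_eq)
    then show "i = j" using turn_power_inj by (simp add: inj_eq)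
  qed
  then have "card {..card G} \<le> card G"
    using h(2) \<open>finite G\<close> by (intro card_inj_on_le[where f = "\<lambda>j. h \<circ> (\<lambda>z. turn ^ j * z)"]) auto
  then show False by simp
qed

lemma infinite_orientations:
  assumes "hierarchical_tiling leg_a leg_b \<T>" "s \<in> tile_size ` \<T>"
  shows "infinite {g. \<exists>t \<in> \<T>. tile_size t = s \<and> has_orientation leg_a leg_b t g}"
proof (rule infinite_rotations)
  fix n
  obtain L where L: "L > 0" "tile_size ` \<T> = {L, ratio * L}"
    "\<And>n. \<exists>N r g f. n \<le> N \<and> similarity r g f \<and>
       map_tile f ` level_tiles leg_a leg_b N \<subseteq> \<T> \<and> r * (4 * ratio ^ N) = L"
    using hierarchical_supertiles[OF assms(1)] by blast
  obtain N r g f where f: "2 * n + 1 \<le> N" "similarity r g f"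
    "map_tile f ` level_tiles leg_a leg_b N \<subseteq> \<T>" "r * (4 * ratio ^ N) = L"
    using L(3) by blast
  \<comment> \<open>The exponent \<open>K\<close> is \<open>N\<close> for the larger size and
    \<open>Suc N\<close> for the smaller.\<close>
  obtain K where K: "s = r * (4 * ratio ^ K)" "\<exists>h. inj h \<and> (\<forall>j\<le>n. \<exists>t \<in> level_tiles leg_a leg_b N. \<exists>f.
    similarity (ratio ^ K) (h \<circ> (\<lambda>z. turn ^ j * z)) f \<and> t = map_tile f basic)"
  proof (cases "s = L")
    case True
    then show ?thesis using that[of N] level_tiles_orientations[of n N] f(1,4) by simp
  next
    case False
    then have "s = ratio * L" using L(2) assms(2) by blast
    then show ?thesis using that[of "Suc N"] level_tiles_small_orientations[of n N] f(1,4) by (simp add: ac_simps)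
  qed
  then obtain h where h: "inj h" "\<And>j. j \<le> n \<Longrightarrow> \<exists>t \<in> level_tiles leg_a leg_b N. \<exists>f.
    similarity (ratio ^ K) (h \<circ> (\<lambda>z. turn ^ j * z)) f \<and> t = map_tile f basic" by blast
  have "inj g" using f(2) orthogonal_transformation_inj by (auto simp: similarity_def)
  then have "inj (g \<circ> h)" using h(1) by (rule inj_compose)
  moreover have "\<exists>t \<in> \<T>. tile_size t = s \<and>
      has_orientation leg_a leg_b t (g \<circ> h \<circ> (\<lambda>z. turn ^ j * z))" if j: "j \<le> n" for j
  proof -
    obtain t f' where t: "t \<in> level_tiles leg_a leg_b N" "t = map_tile f' basic"
      "similarity (ratio ^ K) (h \<circ> (\<lambda>z. turn ^ j * z)) f'" using h(2)[OF j] by blast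
    have *: "similarity (r * ratio ^ K) (g \<circ> h \<circ> (\<lambda>z. turn ^ j * z)) (f \<circ> f')"
      using similarity_comp[OF f(2) t(3)] by (simp add: comp_assoc)
    have "map_tile f t = map_tile (f \<circ> f') basic" by (simp add: t(2) map_tile_comp)
    then have "has_orientation leg_a leg_b (map_tile f t) (g \<circ> h \<circ> (\<lambda>z. turn ^ j * z))"
      "tile_size (map_tile f t) = s"
      using similarity_orientation[OF *] size_map_tile[OF *, of basic] by (simp_all add: size_basic K(1))
    moreover have "map_tile f t \<in> \<T>" using f(3) t(1) by blast
    ultimately show ?thesis by blast
  qed
  ultimately show "\<exists>h. inj h \<and> (\<forall>j\<le>n. h \<circ> (\<lambda>z. turn ^ j * z) \<in>
      {g. \<exists>t \<in> \<T>. tile_size t = s \<and> has_orientation leg_a leg_b t g})"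
    by blast
qed

section \<open>Fault lines inside the tiling\<close>

text \<open>One length \<open>L\<close> serves all pairs and all \<open>n\<close>, so that distances
  from different supertiles can be compared.\<close>

lemma fault_pair_in_tiling:
  assumes "hierarchical_tiling leg_a leg_b \<T>"
  shows "\<exists>L>0. \<forall>n s t. fault_pair n s t \<longrightarrow> (\<exists>o' v t1 t2. t1 \<in> \<T> \<and> t2 \<in> \<T> \<and>
    placed o' v s t1 \<and> placed o' v t t2 \<and> norm v = L)"
proof -
  obtain L where L: "L > 0"
    "\<And>n. \<exists>N r g f. n \<le> N \<and> similarity r g f \<and>
       map_tile f ` level_tiles leg_a leg_b N \<subseteq> \<T> \<and> r * (4 * ratio ^ N) = L"
    using hierarchical_supertiles[OF assms] by blast
  have "\<exists>o' v t1 t2. t1 \<in> \<T> \<and> t2 \<in> \<T> \<and> placed o' v s t1 \<and> placed o' v t t2 \<and> norm v = L / lam"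
    if fp: "fault_pair n s t" for n s t
  proof -
    obtain N r g f where f: "2 + 2 * n \<le> N" "similarity r g f"
      "map_tile f ` level_tiles leg_a leg_b N \<subseteq> \<T>" "r * (4 * ratio ^ N) = L"
      using L(2) by blast
    define w where "w = N - (2 + 2 * n)"
    have N: "w + 2 + 2 * n = N" using f(1) by (simp add: w_def)
    obtain o' v t1 t2 where *: "tile_at N t1" "tile_at N t2"
      "placed o' v s t1" "placed o' v t t2" "norm v = 4 * ratio ^ N / lam"
      using fault_pair_realised[OF fp, of w] unfolding N by blast
    have "norm (r *\<^sub>R g v) = L / lam"
      using f(2,4) *(5) by (auto simp: similarity_def orthogonal_transformation)
    moreover have "map_tile f t1 \<in> \<T>" "map_tile f t2 \<in> \<T>"
      using f(3) *(1,2) unfolding level_tiles_eq by blast+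
    ultimately show ?thesis using placed_map[OF f(2)] *(3,4) by blast
  qed
  then show ?thesis using L(1) lam_pos by (intro exI[of _ "L / lam"]) auto
qed

text \<open>After one step a long leg of length 2 and a hypotenuse of length \<open>lam\<close>
  start from the same point on opposite sides of the fault line; the half leg of length 1 is a
  proper part of the hypotenuse.\<close>

lemma not_globally_edge_to_edge:
  assumes "hierarchical_tiling leg_a leg_b \<T>"
  shows "\<not> globally_edge_to_edge \<T>"
proof
  assume edge: "globally_edge_to_edge \<T>"
  have "fault_pair (Suc 0) (False, 1, 0, 0) (True, - 1, 0, 1)"
    using fault_pair.start by (rule fault_pair.step) auto
  then obtain L o' v t u where L: "L > 0" "t \<in> \<T>" "u \<in> \<T>"
    "placed o' v (False, 1, 0, 0) t" "placed o' v (True, - 1, 0, 1) u" "norm v = L"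
    using fault_pair_in_tiling[OF assms] by blast
  obtain A C B A' C' B' where tu: "t = (A, C, B)" "u = (A', C', B')" by (metis surj_pair)
  have pts: "A = o'" "C = o' + 2 *\<^sub>R v" "A' = o' + lam *\<^sub>R v" "B' = o'"
    using L(4,5) by (simp_all add: tu)
  have "v \<noteq> 0" using L by auto
  then have "t \<noteq> u" using lam_pos by (simp add: tu pts)
  then have meet: "meet_full_edges t u"
    using edge L(2,3) by (auto simp: globally_edge_to_edge_def pairwise_def)
  have mid: "midpoint A C = o' + v"
    by (simp add: pts midpoint_def complex_eq_iff)
  have "o' + v = o' + 1 *\<^sub>R v" "o' = o' + 0 *\<^sub>R v" by simp_all
  then have "o' + v \<in> closed_segment A' B'" "o' \<in> closed_segment A' B'"
    using in_line_segment[of lam 0 1 o' v] lam_bounds by (auto simp: pts)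
  then have "closed_segment o' (o' + v) \<subseteq> closed_segment A' B'"
    by (intro closed_segment_subset convex_closed_segment)
  then have "closed_segment o' (o' + v) \<subseteq> closed_segment A (midpoint A C) \<inter> closed_segment A' B'"
    unfolding mid unfolding pts(1) by blast
  then have "share_segment (closed_segment A (midpoint A C)) (closed_segment A' B')"
    using \<open>v \<noteq> 0\<close> unfolding share_segment_def by (metis add_cancel_right_right)
  then have "closed_segment A (midpoint A C) = closed_segment A' B'"
    using meet by (simp add: meet_full_edges_def tu)
  then have "{o', o' + v} = {o' + lam *\<^sub>R v, o'}"
    unfolding closed_segment_eq mid by (simp add: pts)
  then have "v = lam *\<^sub>R v" using \<open>v \<noteq> 0\<close> by (auto simp: doubleton_eq_iff)
  then have "(1 - lam) *\<^sub>R v = 0" by (simp add: scaleR_diff_left)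
  then show False using \<open>v \<noteq> 0\<close> lam_bounds by simp
qed

section \<open>Infinitely many ways of meeting\<close>

text \<open>A congruence invariant, as \<open>map_tile\<close> keeps the order of the vertices. It
  is a set because pairs are unordered.\<close>

definition corner_distances :: "tile set \<Rightarrow> real set" where
  "corner_distances P = {dist (fst t) (fst u) | t u. t \<in> P \<and> u \<in> P}"

lemma corner_distances_motion:
  assumes "euclidean_motion e"
  shows "corner_distances (map_tile e ` P) = corner_distances P"
proof -
  have "dist (e x) (e y) = dist x y" for x y
    using assms by (auto simp: euclidean_motion_def dist_norm orthogonal_transformation
        simp flip: linear_diff)
  then have *: "dist (fst (map_tile e t)) (fst (map_tile e u)) = dist (fst t) (fst u)" for t u
    by (cases t; cases u) simp
  have "corner_distances (map_tile e ` P) =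
      {dist (fst (map_tile e t)) (fst (map_tile e u)) | t u. t \<in> P \<and> u \<in> P}"
    unfolding corner_distances_def by blast
  then show ?thesis unfolding * corner_distances_def .
qed

text \<open>The invariant is constant on each congruence class and finite for each pair.\<close>

lemma finite_corner_distances:
  assumes "finite (meeting_ways \<T>)"
  shows "finite (\<Union> (corner_distances ` meeting_pairs \<T>))"
proof -
  have "\<exists>P0. corner_distances ` X \<subseteq> {corner_distances P0}" if "X \<in> meeting_ways \<T>" for X
    using that corner_distances_motion
    unfolding meeting_ways_def quotient_def congruent_pairs_def by fastforce
  then have "finite (corner_distances ` X)" if "X \<in> meeting_ways \<T>" for X
    using that by (meson finite.emptyI finite_insert finite_subset)
  then have "finite (\<Union>X \<in> meeting_ways \<T>. corner_distances ` X)"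
    using assms by blast
  moreover have "P \<in> congruent_pairs \<T> `` {P}" if "P \<in> meeting_pairs \<T>" for P
  proof -
    have "map_tile (\<lambda>x. x) = (\<lambda>t. t)" by (auto simp: fun_eq_iff)
    moreover have "euclidean_motion (\<lambda>x. x)"
      unfolding euclidean_motion_def
      by (intro exI[of _ "\<lambda>x. x"] exI[of _ 0]) (simp add: orthogonal_transformation_def linear_ident)
    ultimately show ?thesis using that unfolding congruent_pairs_def
      by (auto intro!: exI[of _ "\<lambda>x. x"])
  qed
  then have "corner_distances ` meeting_pairs \<T> \<subseteq> (\<Union>X \<in> meeting_ways \<T>. corner_distances ` X)"
    unfolding meeting_ways_def quotient_def by blast
  ultimately have "finite (corner_distances ` meeting_pairs \<T>)" by (rule finite_subset[rotated])
  moreover have "finite (corner_distances P)" if P: "P \<in> meeting_pairs \<T>" for P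
  proof -
    have "finite P" using P by (auto simp: meeting_pairs_def)
    then have "finite ((\<lambda>(t, u). dist (fst t) (fst u)) ` (P \<times> P))" by simp
    moreover have "corner_distances P \<subseteq> (\<lambda>(t, u). dist (fst t) (fst u)) ` (P \<times> P)"
      unfolding corner_distances_def by force
    ultimately show ?thesis by (rule finite_subset[rotated])
  qed
  ultimately show ?thesis by blast
qed

text \<open>Finitely many distances would leave finitely many offsets in \<open>\<int>[lam]\<close>,
  whose conjugates would then be bounded.\<close>

lemma infinite_meeting_ways:
  assumes "hierarchical_tiling leg_a leg_b \<T>"
  shows "infinite (meeting_ways \<T>)"
proof
  assume "finite (meeting_ways \<T>)"
  define D where "D = \<Union> (corner_distances ` meeting_pairs \<T>)"
  have "finite D" unfolding D_def by (rule finite_corner_distances) fact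
  obtain L where L: "L > 0"
    "\<And>n s t. fault_pair n s t \<Longrightarrow> \<exists>o' v t1 t2. t1 \<in> \<T> \<and> t2 \<in> \<T> \<and>
      placed o' v s t1 \<and> placed o' v t t2 \<and> norm v = L"
    using fault_pair_in_tiling[OF assms] by blast
  define \<phi> where "\<phi> = (\<lambda>(m :: int, k :: int). of_int m + of_int k * lam)"
  \<comment> \<open>A distance determines the offset only up to sign, hence the two images.\<close>
  define Z where "Z = \<phi> -` ((\<lambda>d. d / L) ` D \<union> (\<lambda>d. - d / L) ` D)"
  have "inj \<phi>" by (auto simp: inj_def \<phi>_def int_lam_eq_iff)
  then have "finite Z" unfolding Z_def using \<open>finite D\<close> by (intro finite_vimageI) auto
  then have "finite ((\<lambda>(m, k). \<bar>of_int m + of_int k * lam_conj\<bar>) ` Z)" by simp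
  then obtain b where b: "\<And>m k. (m, k) \<in> Z \<Longrightarrow> \<bar>of_int m + of_int k * lam_conj\<bar> \<le> b"
    by (force dest!: bdd_above_finite simp: bdd_above_def)
  \<comment> \<open>Chosen so that the lower bound \<open>15.5 + n / 2\<close> exceeds
    \<open>b\<close>.\<close>
  obtain n :: nat where n: "2 * b < n" using reals_Archimedean2 by blast
  obtain s t where st: "fault_pair (n + 4) s t" "oriented s" "oriented t" "overlap s t"
     "15.5 + n / 2 \<le> \<bar>near_conj s - near_conj t\<bar>"
    using fault_pair_offsets by blast
  obtain o' v t1 t2 where v: "t1 \<in> \<T>" "t2 \<in> \<T>" "placed o' v s t1" "placed o' v t t2" "norm v = L"
    using L(2)[OF st(1)] by blast
  obtain h e m k h' e' m' k' where eqs: "s = (h, e, m, k)" "t = (h', e', m', k')"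
    by (metis surj_pair)
  have conj: "near_conj s - near_conj t = of_int (m - m') + of_int (k - k') * lam_conj"
    by (simp add: eqs algebra_simps)
  have near: "near_end s - near_end t = \<phi> (m - m', k - k')"
    by (simp add: eqs \<phi>_def algebra_simps)
  have "v \<noteq> 0" using v(5) L(1) by auto
  have "fst t1 - fst t2 = (near_end s - near_end t) *\<^sub>R v"
    using v(3,4) by (cases t1; cases t2) (simp add: scaleR_diff_left)
  then have d: "dist (fst t1) (fst t2) = \<bar>\<phi> (m - m', k - k')\<bar> * L"
    unfolding near by (simp add: dist_norm v(5))
  \<comment> \<open>A vanishing offset would have a vanishing conjugate, against the lower bound;
    this makes the two tiles distinct.\<close>
  have "\<phi> (m - m', k - k') \<noteq> 0"
  proof
    assume "\<phi> (m - m', k - k') = 0"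
    then have "m - m' = 0 \<and> k - k' = 0" unfolding \<phi>_def prod.case by (rule int_lam_eq_0)
    then show False using st(5) unfolding conj by simp
  qed
  then have "t1 \<noteq> t2" using d L(1) by auto
  then have "{t1, t2} \<in> meeting_pairs \<T>"
    using v(1,2) placed_share_segment[OF v(3,4) \<open>v \<noteq> 0\<close> st(2-4)]
    unfolding meeting_pairs_def by blast
  then have "\<bar>\<phi> (m - m', k - k')\<bar> * L \<in> D"
    unfolding D_def corner_distances_def d[symmetric] by blast
  then have "(m - m', k - k') \<in> Z"
  proof -
    let ?x = "\<phi> (m - m', k - k')"
    assume D: "\<bar>?x\<bar> * L \<in> D"
    have "?x = (\<bar>?x\<bar> * L) / L \<or> ?x = - (\<bar>?x\<bar> * L) / L" using L(1) by (auto simp: abs_if)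
    with D show ?thesis unfolding Z_def by blast
  qed
  then show False using b st(5) n unfolding conj by force
qed

theorem theorem5:
  fixes a b c :: real and \<T> :: "tile set"
  assumes "a = sqrt (2 * (sqrt 17 - 1))"
    and "b = sqrt 17 - 1"
    and "c = 4"
    and "hierarchical_tiling a b \<T>"
  shows "a\<^sup>2 + b\<^sup>2 = c\<^sup>2 \<and> ln (a / c) / ln (b / (2 * c)) = 1 / 2 \<and>
    card (tile_size ` \<T>) = 2 \<and>
    (\<forall>s \<in> tile_size ` \<T>.
       infinite {g. \<exists>t \<in> \<T>. tile_size t = s \<and> has_orientation a b t g}) \<and>
    sibling_edge_to_edge a b c \<and>
    \<not> globally_edge_to_edge \<T> \<and>
    infinite (meeting_ways \<T>)"
proof -
  have ab: "a = leg_a" "b = leg_b" using assms(1,2) by (simp_all add: leg_a_def leg_b_def)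
  have T: "hierarchical_tiling leg_a leg_b \<T>" using assms(4) by (simp add: ab)
  have "ln ratio \<noteq> 0" using ratio_pos ratio_less_1 by simp
  moreover have "ln (ratio * ratio) = 2 * ln ratio" using ratio_pos by (simp add: ln_mult)
  ultimately have "ln (a / c) / ln (b / (2 * c)) = 1 / 2"
    unfolding ratio_sq(1) by (simp add: ab assms(3) ratio_def)
  moreover obtain L where "L > 0" "tile_size ` \<T> = {L, ratio * L}"
    using hierarchical_supertiles[OF T] by blast
  then have "card (tile_size ` \<T>) = 2" using ratio_less_1 by simp
  moreover have "a\<^sup>2 + b\<^sup>2 = c\<^sup>2" using legs_sq by (simp add: ab assms(3) power2_eq_square)
  ultimately show ?thesis
    using infinite_orientations[OF T] not_globally_edge_to_edge[OF T] infinite_meeting_ways[OF T]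
      sibling_edge_to_edge
    unfolding ab assms(3) by blast
qed

end
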